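(* Let $M>0$, $\mu\in(0,2]$, $T\ge4$, $\delta\in(0,\tfrac12)$, and let $\mathcal F=\{f_1,\ldots,f_K\}$ be a finite class of real-valued functions on $\mathcal X$. Suppose that $|f(X)|\le\tfrac12M$ almost surely for all $f\in\mathcal F$, that $|\partial_y\ell(y,Y)|\le M$ almost surely for all $y$ with $|y|\le\tfrac12M$, and that $\ell$ is $\mu$-strongly convex in its first argument. Then, with probability at least $1-\delta$, Algorithm 3 (defined in the context) with input parameters $T$, $M$, $\eta=\frac{\mu}{8}$ and stopping threshold $$\mathcal S=\frac{8M^2\log K}{\mu}+M^2\Big(\frac{32}{\mu}+3\mu+4\Big)\log\!\Big(\frac{\log T}{\delta}\Big)$$ outputs $\hat f$, after $S$ steps, satisfying $$R(\hat f)-\min_{f\in\mathcal F}R(f)\le\begin{cases}0&\text{if }S<T,\\[4pt]\dfrac{M^2}{\mu T}\Big(8\log K+(32+3\mu^2+4\mu)\log\big(\tfrac{\log T}{\delta}\big)\Big)&\text{if }S=T.\end{cases}$$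
   Context: Setting: $(X_t,Y_t)_{t=1}^T$ are i.i.d. copies of $(X,Y)\sim\mathbb P$ on $\mathcal X\times\mathbb R$; $\ell:\mathbb R^2\to\mathbb R$ is a loss, differentiable in its first argument; the risk of $f:\mathcal X\to\mathbb R$ is $R(f)=\mathbb E\,\ell(f(X),Y)$, where for data-dependent $\hat f$ the expectation is over an independent pair $(X,Y)$. "$\mu$-strongly convex in its first argument" means $\ell(y,Y)-\ell(x,Y)\le(y-x)\partial_y\ell(y,Y)-\frac\mu2(x-y)^2$ for all $x,y\in[-\tfrac12M,\tfrac12M]$. Write $\ell_t(\cdot)=\ell(\cdot,Y_t)$. $\log$ is the natural logarithm. Algorithm 1 (with $\kappa_t\equiv1$; inputs $\eta$, $M$): set $\gamma=\eta/M^2$, $p_1(i)=1/K$. In round $t$: receive expert predictions $y_t(1),\ldots,y_t(K)$; predict $\hat y_t=\sum_{i=1}^Kp_t(i)y_t(i)$; receive $g_t$; set $\tilde\ell_t(i)=\gamma(y_t(i)-\hat y_t)g_t+\big(\gamma(y_t(i)-\hat y_t)g_t\big)^2$; set $p_{t+1}(i)\propto\exp\!\big(-\sum_{s=1}^t\tilde\ell_s(i)\big)$, normalized to sum to one. Algorithm 3 (early-stopping online to batch; inputs $T$, $M$, $\eta$, threshold $\mathcal S$): start with $S=0$. While $S<T$ and $\mathcal S>\frac\mu8\min_{f\in\mathcal F}\sum_{t=1}^S(\hat y_t-f(X_t))^2$: perform round $t=S+1$ of Algorithm 1 (inputs $\eta,M$) with expert predictions $y_t(i)=f_i(X_t)$,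 giving $p_t$ and $\hat y_t=\sum_ip_t(i)f_i(X_t)$, with feedback $g_t=\ell_t'(\hat y_t)$, then increase $S$ by one. Output $\hat f=\frac1S\sum_{t=1}^S\sum_{i=1}^Kp_t(i)f_i$, where $S$ is the number of steps performed. *)

theory Defs
  imports "HOL-Probability.Probability"
begin

definition prediction :: "nat \<Rightarrow> (nat \<Rightarrow> real) \<Rightarrow> (nat \<Rightarrow> real) \<Rightarrow> real" where
  "prediction K p y = (\<Sum>i=1..K. p i * y i)"

text \<open>Here \<open>g\<close> maps the learner's prediction to the feedback it triggers, e.g. the derivative of
  the round's loss at that point.\<close>

definition surrogate_loss ::
    "nat \<Rightarrow> real \<Rightarrow> (nat \<Rightarrow> real) \<Rightarrow> (real \<Rightarrow> real) \<Rightarrow> (nat \<Rightarrow> real) \<Rightarrow> nat \<Rightarrow> real" where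
  "surrogate_loss K \<gamma> y g p i =
     (let yhat = prediction K p y; u = \<gamma> * (y i - yhat) * g yhat in u + u\<^sup>2)"

text \<open>The weights \<open>p\<^sub>t\<close> of the expert algorithm, for rounds \<open>t \<ge> 1\<close> and experts \<open>1, \<dots>, K\<close>, where
  \<open>y t i\<close> is the prediction of expert \<open>i\<close> in round \<open>t\<close> and \<open>g t\<close> the feedback function of round \<open>t\<close>.
  At \<open>t = 1\<close> the inner sum is empty, which gives the uniform weights \<open>1 / K\<close>.\<close>

fun expert_weights ::
    "nat \<Rightarrow> real \<Rightarrow> real \<Rightarrow> (nat \<Rightarrow> nat \<Rightarrow> real) \<Rightarrow> (nat \<Rightarrow> real \<Rightarrow> real) \<Rightarrow> nat \<Rightarrow> nat \<Rightarrow> real" where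
  "expert_weights K \<eta> M y g t =
     (let w = (\<lambda>i. exp (- (\<Sum>s\<in>{1..<t}.
                  surrogate_loss K (\<eta> / M\<^sup>2) (y s) (g s) (expert_weights K \<eta> M y g s) i)))
      in (\<lambda>i. w i / (\<Sum>j=1..K. w j)))"

declare expert_weights.simps [simp del]

text \<open>Online to batch: a sample is a sequence \<open>z\<close> of pairs, with \<open>z t = (X\<^sub>t, Y\<^sub>t)\<close> for \<open>t \<ge> 1\<close>; the
  class is \<open>f 1, \<dots>, f K\<close>.\<close>

definition otb_weights ::
    "(real \<Rightarrow> real \<Rightarrow> real) \<Rightarrow> nat \<Rightarrow> (nat \<Rightarrow> 'a \<Rightarrow> real) \<Rightarrow> real \<Rightarrow> real \<Rightarrow> (nat \<Rightarrow> 'a \<times> real) \<Rightarrow>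
     nat \<Rightarrow> nat \<Rightarrow> real" where
  "otb_weights l K f \<eta> M z =
     expert_weights K \<eta> M (\<lambda>t i. f i (fst (z t))) (\<lambda>t. deriv (\<lambda>u. l u (snd (z t))))"

definition otb_prediction ::
    "(real \<Rightarrow> real \<Rightarrow> real) \<Rightarrow> nat \<Rightarrow> (nat \<Rightarrow> 'a \<Rightarrow> real) \<Rightarrow> real \<Rightarrow> real \<Rightarrow> (nat \<Rightarrow> 'a \<times> real) \<Rightarrow>
     nat \<Rightarrow> real" where
  "otb_prediction l K f \<eta> M z t =
     prediction K (otb_weights l K f \<eta> M z t) (\<lambda>i. f i (fst (z t)))"

text \<open>The number of steps of the while loop is the least counter value at which its guard fails;
  this is at most \<open>T\<close>. The argument \<open>\<theta>\<close> is the stopping threshold.\<close>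

definition otb_guard ::
    "(real \<Rightarrow> real \<Rightarrow> real) \<Rightarrow> real \<Rightarrow> nat \<Rightarrow> (nat \<Rightarrow> 'a \<Rightarrow> real) \<Rightarrow> nat \<Rightarrow> real \<Rightarrow> real \<Rightarrow> real \<Rightarrow>
     (nat \<Rightarrow> 'a \<times> real) \<Rightarrow> nat \<Rightarrow> bool" where
  "otb_guard l \<mu> K f T M \<eta> \<theta> z s \<longleftrightarrow>
     s < T \<and>
     \<theta> > \<mu> / 8 * (MIN i\<in>{1..K}. \<Sum>t=1..s. (otb_prediction l K f \<eta> M z t - f i (fst (z t)))\<^sup>2)"

definition otb_steps ::
    "(real \<Rightarrow> real \<Rightarrow> real) \<Rightarrow> real \<Rightarrow> nat \<Rightarrow> (nat \<Rightarrow> 'a \<Rightarrow> real) \<Rightarrow> nat \<Rightarrow> real \<Rightarrow> real \<Rightarrow> real \<Rightarrow>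
     (nat \<Rightarrow> 'a \<times> real) \<Rightarrow> nat" where
  "otb_steps l \<mu> K f T M \<eta> \<theta> z = (LEAST s. \<not> otb_guard l \<mu> K f T M \<eta> \<theta> z s)"

definition otb_output ::
    "(real \<Rightarrow> real \<Rightarrow> real) \<Rightarrow> real \<Rightarrow> nat \<Rightarrow> (nat \<Rightarrow> 'a \<Rightarrow> real) \<Rightarrow> nat \<Rightarrow> real \<Rightarrow> real \<Rightarrow> real \<Rightarrow>
     (nat \<Rightarrow> 'a \<times> real) \<Rightarrow> 'a \<Rightarrow> real" where
  "otb_output l \<mu> K f T M \<eta> \<theta> z x =
     (let S = otb_steps l \<mu> K f T M \<eta> \<theta> z
      in 1 / real S * (\<Sum>t=1..S. \<Sum>i=1..K. otb_weights l K f \<eta> M z t i * f i x))"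

definition risk :: "('a \<times> real) measure \<Rightarrow> (real \<Rightarrow> real \<Rightarrow> real) \<Rightarrow> ('a \<Rightarrow> real) \<Rightarrow> real" where
  "risk P l h = (\<integral>z. l (h (fst z)) (snd z) \<partial>P)"

text \<open>Strong convexity is required almost surely in the second argument.\<close>

definition strongly_convex_loss ::
    "('a \<times> real) measure \<Rightarrow> real \<Rightarrow> real \<Rightarrow> (real \<Rightarrow> real \<Rightarrow> real) \<Rightarrow> bool" where
  "strongly_convex_loss P M \<mu> l \<longleftrightarrow>
     (AE z in P. \<forall>x\<in>{- (M / 2)..M / 2}. \<forall>y\<in>{- (M / 2)..M / 2}.
        l y (snd z) - l x (snd z) \<le>
          (y - x) * deriv (\<lambda>u. l u (snd z)) y - \<mu> / 2 * (x - y)\<^sup>2)"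

end

theory Submission
  imports Defs
begin

text \<open>Let \<open>f i\<close> be the best function, \<open>d t\<close> the squared distance between the predictions of the
  learner and of \<open>f i\<close> in round \<open>t\<close>, and \<open>r t\<close> the linearised regret of that round. Strong convexity
  bounds the conditional excess risk of round \<open>t\<close> by the conditional expectation of
  \<open>r t - \<mu> / 2 * d t\<close>, and the second-order regret bound of the expert algorithm gives
  \<open>(\<Sum>t. r t) \<le> 8 * M\<^sup>2 * ln K / \<mu> + \<mu> / 8 * (\<Sum>t. d t)\<close>. It remains to control the deviations of
  \<open>\<mu> / 4 * d t - r t\<close>. Its conditional second moment is at most a multiple of the conditional mean
  of \<open>d t\<close>, and half of the strong convexity term is left to pay for it; hence a single exponential
  supermartingale with a fixed tilting parameter, stopped with the algorithm, and Markov's inequality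
  suffice, without a union bound over variance levels. The sum of the three bounds is at most the
  threshold minus \<open>\<mu> / 8 * (\<Sum>t. d t)\<close>, which is nonpositive after an early stop.\<close>

subsection \<open>Exponential weights\<close>

text \<open>For negative \<open>x = - y\<close>, the factor \<open>exp y\<close> is bounded below by
  its quadratic Taylor polynomial; multiplied with the claimed bound this is at least
  \<open>1\<close>.\<close>

lemma exp_le_quadratic:
  fixes x :: real
  assumes "\<bar>x\<bar> \<le> 1"
  shows "exp x \<le> 1 + x + x\<^sup>2"
proof (cases "0 \<le> x")
  case True
  then show ?thesis using assms exp_bound by auto
next
  case False
  define y where "y = - x"
  have y: "0 \<le> y" "x = - y" using False by (auto simp: y_def)
  have "1 \<le> 1 + y\<^sup>2 / 2 + y ^ 3 / 2 + y ^ 4 / 2" using y by simp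
  also have "\<dots> = (1 - y + y\<^sup>2) * (1 + y + y\<^sup>2 / 2)"
    by (simp add: field_simps power2_eq_square power3_eq_cube power4_eq_xxxx)
  also have "\<dots> \<le> (1 - y + y\<^sup>2) * exp y"
  proof (rule mult_left_mono)
    show "1 + y + y\<^sup>2 / 2 \<le> exp y" using y exp_lower_Taylor_quadratic by blast
    show "0 \<le> 1 - y + y\<^sup>2" using y assms by simp
  qed
  finally show ?thesis using y by (simp add: exp_minus field_simps)
qed

lemma exp_neg_quadratic_le:
  fixes u :: real
  assumes "\<bar>u\<bar> \<le> 1 / 2"
  shows "exp (- (u + u\<^sup>2)) \<le> 1 - u"
proof -
  have "- (u + u\<^sup>2) \<le> ln (1 - u)"
  proof (cases "u \<le> 0")
    case True
    then show ?thesis using ln_one_plus_pos_lower_bound[of "- u"] assms by simp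
  next
    case False
    \<comment> \<open>The difference of the two sides vanishes at \<open>0\<close>, and the factor
      \<open>1 - 2 * v\<close> of its derivative stays nonnegative exactly up to
      \<open>1 / 2\<close>.\<close>
    have "(\<lambda>v. ln (1 - v) + v + v\<^sup>2) 0 \<le> (\<lambda>v. ln (1 - v) + v + v\<^sup>2) u"
    proof (rule DERIV_nonneg_imp_nondecreasing[where f="\<lambda>v. ln (1 - v) + v + v\<^sup>2"])
      show "0 \<le> u" using False by simp
      fix v assume v: "0 \<le> v" "v \<le> u"
      have "((\<lambda>v. ln (1 - v) + v + v\<^sup>2) has_real_derivative v * (1 - 2 * v) / (1 - v)) (at v)"
        using v assms by (auto intro!: derivative_eq_intros simp: field_simps power2_eq_square)
      moreover have "0 \<le> v * (1 - 2 * v) / (1 - v)" using v assms by auto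
      ultimately show "\<exists>y. ((\<lambda>v. ln (1 - v) + v + v\<^sup>2) has_real_derivative y) (at v) \<and> 0 \<le> y"
        by blast
    qed
    then show ?thesis by simp
  qed
  then have "exp (- (u + u\<^sup>2)) \<le> exp (ln (1 - u))" by simp
  then show ?thesis using assms by simp
qed

text \<open>Only coordinates in \<open>{1..K}\<close> are constrained, because
  \<open>expert_weights\<close> may take nonzero values outside that range.\<close>

definition prob_vectors :: "nat \<Rightarrow> (nat \<Rightarrow> real) set" where
  "prob_vectors K = {p. (\<forall>i\<in>{1..K}. 0 \<le> p i) \<and> (\<Sum>i=1..K. p i) = 1}"

lemma abs_prediction_le:
  assumes "p \<in> prob_vectors K" and "\<And>i. i \<in> {1..K} \<Longrightarrow> \<bar>y i\<bar> \<le> B"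
  shows "\<bar>prediction K p y\<bar> \<le> B"
proof -
  have "\<bar>prediction K p y\<bar> \<le> (\<Sum>i=1..K. \<bar>p i * y i\<bar>)"
    unfolding prediction_def by (rule sum_abs)
  also have "\<dots> \<le> (\<Sum>i=1..K. p i * B)"
    using assms by (intro sum_mono) (auto simp: prob_vectors_def abs_mult intro!: mult_left_mono)
  also have "\<dots> = B" using assms by (simp add: prob_vectors_def flip: sum_distrib_right)
  finally show ?thesis .
qed

lemma expert_weights_in_prob_vectors:
  assumes "K \<ge> 1"
  shows "expert_weights K \<eta> M y g t \<in> prob_vectors K"
proof -
  define w where "w = (\<lambda>i. exp (- (\<Sum>s\<in>{1..<t}.
    surrogate_loss K (\<eta> / M\<^sup>2) (y s) (g s) (expert_weights K \<eta> M y g s) i)))"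
  have p: "expert_weights K \<eta> M y g t = (\<lambda>i. w i / (\<Sum>j=1..K. w j))"
    by (subst expert_weights.simps) (simp add: w_def Let_def)
  have "(\<Sum>j=1..K. w j) > 0" using assms by (intro sum_pos) (auto simp: w_def)
  moreover have "w i \<ge> 0" for i by (simp add: w_def)
  ultimately show ?thesis
    by (auto simp: p prob_vectors_def simp flip: sum_divide_distrib)
qed

text \<open>Predictability: round \<open>t\<close> itself is excluded, so its weights stay fixed
  while its observation is integrated out.\<close>

lemma expert_weights_cong:
  assumes "\<And>s. s \<in> {1..<t} \<Longrightarrow> y s = y' s" and "\<And>s. s \<in> {1..<t} \<Longrightarrow> g s = g' s"
  shows "expert_weights K \<eta> M y g t = expert_weights K \<eta> M y' g' t"
  using assms
proof (induction t rule: less_induct)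
  case (less t)
  have "expert_weights K \<eta> M y g s = expert_weights K \<eta> M y' g' s" if "s \<in> {1..<t}" for s
    using that by (intro less.IH less.prems) auto
  then have "(\<Sum>s\<in>{1..<t}. surrogate_loss K (\<eta> / M\<^sup>2) (y s) (g s) (expert_weights K \<eta> M y g s) i) =
      (\<Sum>s\<in>{1..<t}. surrogate_loss K (\<eta> / M\<^sup>2) (y' s) (g' s) (expert_weights K \<eta> M y' g' s) i)" for i
    using less.prems by (intro sum.cong) auto
  then show ?case by (simp add: expert_weights.simps[where t=t] Let_def)
qed

text \<open>The total unnormalised weight never increases: the surrogate loss is chosen such that
  \<open>exp (- u - u\<^sup>2) \<le> 1 - u\<close>, and the linear parts \<open>u\<close> average to zero under the current
  weights.\<close>

lemma expert_weights_surrogate_regret: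
  assumes K: "i \<in> {1..K}"
    and u: "\<And>t i. t \<in> {1..n} \<Longrightarrow> i \<in> {1..K} \<Longrightarrow>
      \<bar>\<eta> / M\<^sup>2 * (y t i - prediction K (expert_weights K \<eta> M y g t) (y t)) *
        g t (prediction K (expert_weights K \<eta> M y g t) (y t))\<bar> \<le> 1 / 2"
  shows "- ln K \<le> (\<Sum>t=1..n.
    surrogate_loss K (\<eta> / M\<^sup>2) (y t) (g t) (expert_weights K \<eta> M y g t) i)"
proof -
  define p where "p = expert_weights K \<eta> M y g"
  define sl where "sl t i = surrogate_loss K (\<eta> / M\<^sup>2) (y t) (g t) (p t) i" for t i
  define w where "w t i = exp (- (\<Sum>s\<in>{1..<t}. sl s i))" for t i
  define u where "u t i = \<eta> / M\<^sup>2 * (y t i - prediction K (p t) (y t)) *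
        g t (prediction K (p t) (y t))" for t i
  have p: "p t i = w t i / (\<Sum>j=1..K. w t j)" for t i
    unfolding p_def by (subst expert_weights.simps) (simp add: w_def sl_def p_def Let_def)
  have ps: "p t \<in> prob_vectors K" for t
    unfolding p_def using K by (intro expert_weights_in_prob_vectors) auto
  have pos: "(\<Sum>j=1..K. w t j) > 0" for t using K by (intro sum_pos) (auto simp: w_def)
  have sl: "sl t i = u t i + (u t i)\<^sup>2" for t i
    by (simp add: sl_def surrogate_loss_def u_def Let_def)
  have zero: "(\<Sum>i=1..K. p t i * u t i) = 0" for t
  proof -
    have "(\<Sum>i=1..K. p t i * u t i) = \<eta> / M\<^sup>2 * g t (prediction K (p t) (y t)) *
      (\<Sum>i=1..K. p t i * y t i - prediction K (p t) (y t) * p t i)"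
      unfolding sum_distrib_left by (intro sum.cong) (auto simp: u_def algebra_simps)
    also have "(\<Sum>i=1..K. p t i * y t i - prediction K (p t) (y t) * p t i) = 0"
      using ps[of t] unfolding sum_subtractf
      by (simp add: prediction_def prob_vectors_def flip: sum_distrib_left)
    finally show ?thesis by simp
  qed
  have mono: "(\<Sum>i=1..K. w (Suc t) i) \<le> (\<Sum>i=1..K. w t i)" if t: "t \<in> {1..n}" for t
  proof -
    have "w (Suc t) i = w t i * exp (- sl t i)" for i
      using t by (simp add: w_def exp_add atLeastLessThanSuc exp_diff field_simps exp_minus)
    then have "(\<Sum>i=1..K. w (Suc t) i) = (\<Sum>j=1..K. w t j) * (\<Sum>i=1..K. p t i * exp (- sl t i))"
      using pos[of t] by (simp add: p sum_distrib_left)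
    also have "(\<Sum>i=1..K. p t i * exp (- sl t i)) \<le> (\<Sum>i=1..K. p t i * (1 - u t i))"
    proof (intro sum_mono mult_left_mono)
      fix i assume i: "i \<in> {1..K}"
      show "exp (- sl t i) \<le> 1 - u t i"
        unfolding sl using u[OF t i] by (intro exp_neg_quadratic_le) (simp add: u_def p_def)
      show "0 \<le> p t i" using ps i by (auto simp: prob_vectors_def)
    qed
    also have "(\<Sum>i=1..K. p t i * (1 - u t i)) = 1"
      using zero[of t] ps[of t] by (simp add: algebra_simps sum_subtractf prob_vectors_def)
    finally show ?thesis using pos[of t] by simp
  qed
  \<comment> \<open>The induction starts at \<open>w 1\<close>, whose sums are empty, so that all
    \<open>K\<close> weights are \<open>1\<close>.\<close>
  have "m \<le> n \<Longrightarrow> (\<Sum>i=1..K. w (Suc m) i) \<le> K" for m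
  proof (induction m)
    case 0
    show ?case by (simp add: w_def)
  next
    case (Suc m)
    then show ?case using mono[of "Suc m"] by simp
  qed
  then have "(\<Sum>i=1..K. w (Suc n) i) \<le> K" by simp
  moreover have "w (Suc n) i \<le> (\<Sum>i=1..K. w (Suc n) i)"
    using K by (intro member_le_sum) (auto simp: w_def)
  ultimately have "w (Suc n) i \<le> K" by simp
  then have "ln (w (Suc n) i) \<le> ln K" using K by (subst ln_le_cancel_iff) (simp_all add: w_def)
  then show ?thesis by (simp add: w_def sl_def p_def atLeastLessThanSuc_atLeastAtMost)
qed

subsection \<open>Sequential exponential moments\<close>

text \<open>Supermartingale argument: integrating out the last coordinate leaves the earlier factors
  fixed and contributes a factor of at most \<open>1\<close>. Each factor must be measurable on all
  products with \<open>m \<ge> t\<close>, since the induction shortens the product.\<close>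

lemma nn_integral_PiM_prod_le_1:
  fixes P :: "'b measure" and \<phi> :: "nat \<Rightarrow> (nat \<Rightarrow> 'b) \<Rightarrow> ennreal"
  assumes "prob_space P"
    and meas: "\<And>t m. 1 \<le> t \<Longrightarrow> t \<le> m \<Longrightarrow> m \<le> n \<Longrightarrow> \<phi> t \<in> borel_measurable (\<Pi>\<^sub>M i\<in>{1..m}. P)"
    and cong: "\<And>t z z'. (\<And>s. s \<in> {1..t} \<Longrightarrow> z s = z' s) \<Longrightarrow> \<phi> t z = \<phi> t z'"
    and step: "\<And>t z. t \<in> {1..n} \<Longrightarrow> (\<integral>\<^sup>+ y. \<phi> t (z(t := y)) \<partial>P) \<le> 1"
  shows "(\<integral>\<^sup>+ z. (\<Prod>t=1..n. \<phi> t z) \<partial>(\<Pi>\<^sub>M i\<in>{1..n}. P)) \<le> 1"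
  using meas step
proof (induction n)
  case 0
  show ?case by (simp add: PiM_empty)
next
  interpret prob_space P by fact
  interpret product_prob_space "\<lambda>_. P" by standard
  case (Suc n)
  have ins: "{1..Suc n} = insert (Suc n) {1..n}" by auto
  have "(\<integral>\<^sup>+ z. (\<Prod>t=1..Suc n. \<phi> t z) \<partial>(\<Pi>\<^sub>M i\<in>{1..Suc n}. P)) =
    (\<integral>\<^sup>+ z. (\<integral>\<^sup>+ y. (\<Prod>t=1..Suc n. \<phi> t (z(Suc n := y))) \<partial>P) \<partial>(\<Pi>\<^sub>M i\<in>{1..n}. P))"
  proof -
    have "(\<lambda>z. \<Prod>t=1..Suc n. \<phi> t z) \<in> borel_measurable (\<Pi>\<^sub>M i\<in>{1..Suc n}. P)"
      using Suc.prems(1) by (intro borel_measurable_prod_ennreal) auto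
    then show ?thesis unfolding ins by (intro product_nn_integral_insert) auto
  qed
  also have "\<dots> \<le> (\<integral>\<^sup>+ z. (\<Prod>t=1..n. \<phi> t z) \<partial>(\<Pi>\<^sub>M i\<in>{1..n}. P))"
  proof (rule nn_integral_mono)
    fix z assume z: "z \<in> space (\<Pi>\<^sub>M i\<in>{1..n}. P)"
    have m: "(\<lambda>y. \<phi> (Suc n) (z(Suc n := y))) \<in> borel_measurable P"
    proof -
      have "(\<lambda>y. z(Suc n := y)) \<in> P \<rightarrow>\<^sub>M (\<Pi>\<^sub>M i\<in>{1..Suc n}. P)"
        unfolding ins using z by (intro measurable_fun_upd[where J="{1..n}"]) auto
      then show ?thesis using Suc.prems(1)[of "Suc n" "Suc n"] by (rule measurable_compose) auto
    qed
    have "(\<integral>\<^sup>+ y. (\<Prod>t=1..Suc n. \<phi> t (z(Suc n := y))) \<partial>P) =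
      (\<integral>\<^sup>+ y. (\<Prod>t=1..n. \<phi> t z) * \<phi> (Suc n) (z(Suc n := y)) \<partial>P)"
    proof (intro nn_integral_cong)
      fix y
      have "(\<Prod>t=1..n. \<phi> t (z(Suc n := y))) = (\<Prod>t=1..n. \<phi> t z)"
        by (intro prod.cong refl cong) auto
      then show "(\<Prod>t=1..Suc n. \<phi> t (z(Suc n := y))) =
        (\<Prod>t=1..n. \<phi> t z) * \<phi> (Suc n) (z(Suc n := y))" by simp
    qed
    also have "\<dots> = (\<Prod>t=1..n. \<phi> t z) * (\<integral>\<^sup>+ y. \<phi> (Suc n) (z(Suc n := y)) \<partial>P)"
      using m by (rule nn_integral_cmult)
    also have "\<dots> \<le> (\<Prod>t=1..n. \<phi> t z) * 1"
      by (intro mult_left_mono Suc.prems(2)) auto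
    finally show "(\<integral>\<^sup>+ y. (\<Prod>t=1..Suc n. \<phi> t (z(Suc n := y))) \<partial>P) \<le> (\<Prod>t=1..n. \<phi> t z)" by simp
  qed
  also have "\<dots> \<le> 1" using Suc by (intro Suc.IH) auto
  finally show ?case .
qed

text \<open>Independence and the common law make the joint law of the sample a product
  measure.\<close>

lemma nn_integral_indep_prod_le_1:
  fixes P :: "'b measure" and \<phi> :: "nat \<Rightarrow> (nat \<Rightarrow> 'b) \<Rightarrow> ennreal"
  assumes "prob_space W" and "prob_space P"
    and Z: "prob_space.indep_vars W (\<lambda>_. P) Z {1..n}" "\<And>t. t \<in> {1..n} \<Longrightarrow> distr W P (Z t) = P"
    and meas: "\<And>t m. 1 \<le> t \<Longrightarrow> t \<le> m \<Longrightarrow> m \<le> n \<Longrightarrow> \<phi> t \<in> borel_measurable (\<Pi>\<^sub>M i\<in>{1..m}. P)"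
    and cong: "\<And>t z z'. (\<And>s. s \<in> {1..t} \<Longrightarrow> z s = z' s) \<Longrightarrow> \<phi> t z = \<phi> t z'"
    and step: "\<And>t z. t \<in> {1..n} \<Longrightarrow> (\<integral>\<^sup>+ y. \<phi> t (z(t := y)) \<partial>P) \<le> 1"
  shows "(\<integral>\<^sup>+ \<omega>. (\<Prod>t=1..n. \<phi> t (\<lambda>t. Z t \<omega>)) \<partial>W) \<le> 1"
\<comment> \<open>The product form of the joint law is invoked for a nonempty index set; without
  rounds the product is \<open>1\<close>.\<close>
proof (cases "n = 0")
  case True
  interpret prob_space W by fact
  show ?thesis using True by (simp add: emeasure_space_1)
next
  case False
  interpret prob_space W by fact
  have rv: "random_variable P (Z t)" if "t \<in> {1..n}" for t
    using Z(1) that by (auto simp: indep_vars_def)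
  have PiM: "(\<Pi>\<^sub>M i\<in>{1..n}. distr W P (Z i)) = (\<Pi>\<^sub>M i\<in>{1..n}. P)"
    using Z(2) by (intro PiM_cong) auto
  have "distr W (\<Pi>\<^sub>M i\<in>{1..n}. P) (\<lambda>\<omega>. \<lambda>i\<in>{1..n}. Z i \<omega>) = (\<Pi>\<^sub>M i\<in>{1..n}. P)"
    using indep_vars_iff_distr_eq_PiM'[of "{1..n}" Z "\<lambda>_. P"] Z(1) False rv PiM by auto
  then have "1 \<ge> (\<integral>\<^sup>+ z. (\<Prod>t=1..n. \<phi> t z) \<partial>distr W (\<Pi>\<^sub>M i\<in>{1..n}. P) (\<lambda>\<omega>. \<lambda>i\<in>{1..n}. Z i \<omega>))"
    using nn_integral_PiM_prod_le_1[OF assms(2) meas cong step] by simp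
  also have "(\<integral>\<^sup>+ z. (\<Prod>t=1..n. \<phi> t z) \<partial>distr W (\<Pi>\<^sub>M i\<in>{1..n}. P) (\<lambda>\<omega>. \<lambda>i\<in>{1..n}. Z i \<omega>)) =
    (\<integral>\<^sup>+ \<omega>. (\<Prod>t=1..n. \<phi> t (\<lambda>i\<in>{1..n}. Z i \<omega>)) \<partial>W)"
    using rv meas by (intro nn_integral_distr borel_measurable_prod_ennreal measurable_restrict) auto
  also have "\<dots> = (\<integral>\<^sup>+ \<omega>. (\<Prod>t=1..n. \<phi> t (\<lambda>t. Z t \<omega>)) \<partial>W)"
    by (intro nn_integral_cong prod.cong refl cong) auto
  finally show ?thesis .
qed

section \<open>Measurable derivatives and the confidence logarithm\<close>

text \<open>The derivative is the pointwise limit of difference quotients with increments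
  \<open>1 / (n + 1)\<close>, each measurable because \<open>l\<close> is jointly
  measurable.\<close>

lemma borel_measurable_deriv:
  fixes l :: "real \<Rightarrow> real \<Rightarrow> real"
  assumes l: "(\<lambda>(u, y). l u y) \<in> borel_measurable (borel \<Otimes>\<^sub>M borel)"
    and diff: "\<And>u y. (\<lambda>v. l v y) differentiable (at u)"
    and [measurable]: "a \<in> borel_measurable N" "b \<in> borel_measurable N"
  shows "(\<lambda>x. deriv (\<lambda>u. l u (b x)) (a x)) \<in> borel_measurable N"
proof (rule borel_measurable_LIMSEQ_real)
  fix x
  have "((\<lambda>u. l u (b x)) has_real_derivative deriv (\<lambda>u. l u (b x)) (a x)) (at (a x))"
    using diff by (simp add: DERIV_deriv_iff_real_differentiable)
  then have "((\<lambda>h. (l (a x + h) (b x) - l (a x) (b x)) / h) \<longlongrightarrow> deriv (\<lambda>u. l u (b x)) (a x)) (at 0)"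
    by (simp add: DERIV_def)
  moreover have "filterlim (\<lambda>n. inverse (real (Suc n))) (at 0) sequentially"
    using LIMSEQ_inverse_real_of_nat by (auto simp: filterlim_at)
  ultimately show "(\<lambda>n. (l (a x + inverse (real (Suc n))) (b x) - l (a x) (b x)) / inverse (real (Suc n)))
    \<longlonglongrightarrow> deriv (\<lambda>u. l u (b x)) (a x)"
    by (rule filterlim_compose)
next
  fix n
  have [measurable]: "(\<lambda>x. l (c x) (b x)) \<in> borel_measurable N" if [measurable]: "c \<in> borel_measurable N" for c
    using measurable_compose[OF _ l, of "\<lambda>x. (c x, b x)" N] by simp
  show "(\<lambda>x. (l (a x + inverse (real (Suc n))) (b x) - l (a x) (b x)) / inverse (real (Suc n)))
    \<in> borel_measurable N" by measurable
qed

text \<open>Since \<open>4\<close> exceeds \<open>exp 1\<close>, \<open>ln T\<close> is at least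
  \<open>1\<close>. Thus the logarithm in the threshold dominates the level
  \<open>ln (1 / \<delta>)\<close> that Markov's inequality yields.\<close>

lemma ln_ln_div_bounds:
  fixes T :: nat and \<delta> :: real
  assumes "T \<ge> 4" and "0 < \<delta>" and "\<delta> < 1 / 2"
  shows "ln (1 / \<delta>) \<le> ln (ln (real T) / \<delta>)" and "0 < ln (ln (real T) / \<delta>)"
proof -
  have "exp 1 \<le> real T" using exp_le assms(1) by linarith
  then have "1 \<le> ln (real T)" using assms(1) by (subst ln_ge_iff) auto
  then have "1 / \<delta> \<le> ln (real T) / \<delta>" using assms by (simp add: divide_right_mono)
  then show 1: "ln (1 / \<delta>) \<le> ln (ln (real T) / \<delta>)" using assms by (subst ln_le_cancel_iff) auto
  have "0 < ln (1 / \<delta>)" using assms by (simp add: field_simps)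
  then show "0 < ln (ln (real T) / \<delta>)" using 1 by linarith
qed

subsection \<open>Risks of mixtures\<close>

text \<open>The threshold \<open>\<theta>\<close> stays arbitrary here; its value enters only in the
  theorem.\<close>

locale online_to_batch =
  prob_space P for P :: "('a \<times> real) measure" +
  fixes \<X> :: "'a measure" and l :: "real \<Rightarrow> real \<Rightarrow> real" and f :: "nat \<Rightarrow> 'a \<Rightarrow> real"
    and K T :: nat and M \<mu> \<theta> :: real
  assumes sets_P: "sets P = sets (\<X> \<Otimes>\<^sub>M borel)"
    and l_meas: "(\<lambda>(u, y). l u y) \<in> borel_measurable (borel \<Otimes>\<^sub>M borel)"
    and l_diff: "\<And>u y. (\<lambda>v. l v y) differentiable (at u)"
    and K: "K \<ge> 1"
    and f_meas: "\<And>i. i \<in> {1..K} \<Longrightarrow> f i \<in> borel_measurable \<X>"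
    and M: "M > 0" and \<mu>: "0 < \<mu>" "\<mu> \<le> 2"
    and f_bound: "\<And>i. i \<in> {1..K} \<Longrightarrow> AE z in P. \<bar>f i (fst z)\<bar> \<le> M / 2"
    and deriv_bound: "AE z in P. \<forall>y. \<bar>y\<bar> \<le> M / 2 \<longrightarrow> \<bar>deriv (\<lambda>u. l u (snd z)) y\<bar> \<le> M"
    and strong_convex: "strongly_convex_loss P M \<mu> l"
begin

section \<open>Pointwise bounds for one observation\<close>

definition mix :: "(nat \<Rightarrow> real) \<Rightarrow> 'a \<Rightarrow> real" where
  "mix p x = prediction K p (\<lambda>i. f i x)"

definition sqdist :: "nat \<Rightarrow> (nat \<Rightarrow> real) \<Rightarrow> 'a \<times> real \<Rightarrow> real" where
  "sqdist i p z = (mix p (fst z) - f i (fst z))\<^sup>2"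

definition linreg :: "nat \<Rightarrow> (nat \<Rightarrow> real) \<Rightarrow> 'a \<times> real \<Rightarrow> real" where
  "linreg i p z = (mix p (fst z) - f i (fst z)) * deriv (\<lambda>u. l u (snd z)) (mix p (fst z))"

text \<open>Strong convexity provides \<open>\<mu> / 2 * sqdist\<close>. Half of it is placed here;
  after the regret bound takes \<open>\<mu> / 8\<close>, an empirical \<open>\<mu> / 8\<close>
  remains, which is what the stopping rule measures. The other half appears in
  \<open>drift\<close>.\<close>

definition offset :: "nat \<Rightarrow> (nat \<Rightarrow> real) \<Rightarrow> 'a \<times> real \<Rightarrow> real" where
  "offset i p z = \<mu> / 4 * sqdist i p z - linreg i p z"

text \<open>Gathers the almost sure hypotheses in one property of a single observation, so that
  later bounds are deterministic at such points.\<close>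

definition regular :: "'a \<times> real \<Rightarrow> bool" where
  "regular z \<longleftrightarrow> (\<forall>i\<in>{1..K}. \<bar>f i (fst z)\<bar> \<le> M / 2) \<and>
     (\<forall>y. \<bar>y\<bar> \<le> M / 2 \<longrightarrow> \<bar>deriv (\<lambda>u. l u (snd z)) y\<bar> \<le> M) \<and>
     (\<forall>x\<in>{- (M / 2)..M / 2}. \<forall>y\<in>{- (M / 2)..M / 2}.
        l y (snd z) - l x (snd z) \<le> (y - x) * deriv (\<lambda>u. l u (snd z)) y - \<mu> / 2 * (x - y)\<^sup>2)"

lemma AE_regular: "AE z in P. regular z"
proof -
  have "AE z in P. \<forall>i\<in>{1..K}. \<bar>f i (fst z)\<bar> \<le> M / 2"
    using f_bound by (subst AE_ball_countable) auto
  then show ?thesis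
    using deriv_bound strong_convex unfolding strongly_convex_loss_def
    by eventually_elim (auto simp: regular_def)
qed

lemma mix_bound: "p \<in> prob_vectors K \<Longrightarrow> regular z \<Longrightarrow> \<bar>mix p (fst z)\<bar> \<le> M / 2"
  unfolding mix_def regular_def by (intro abs_prediction_le) auto

lemma deriv_mix_bound:
  "p \<in> prob_vectors K \<Longrightarrow> regular z \<Longrightarrow> \<bar>deriv (\<lambda>u. l u (snd z)) (mix p (fst z))\<bar> \<le> M"
  using mix_bound[of p z] unfolding regular_def by auto

lemma mix_diff_bound:
  assumes "i \<in> {1..K}" "p \<in> prob_vectors K" "regular z"
  shows "\<bar>mix p (fst z) - f i (fst z)\<bar> \<le> M"
proof -
  have "\<bar>f i (fst z)\<bar> \<le> M / 2" using assms by (auto simp: regular_def)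
  then show ?thesis using mix_bound[OF assms(2,3)] by linarith
qed

lemma sqdist_bound:
  "i \<in> {1..K} \<Longrightarrow> p \<in> prob_vectors K \<Longrightarrow> regular z \<Longrightarrow> \<bar>sqdist i p z\<bar> \<le> M\<^sup>2"
  using mix_diff_bound[of i p z] M power_mono[of "\<bar>mix p (fst z) - f i (fst z)\<bar>" M 2]
  by (auto simp: sqdist_def)

lemma linreg_bound:
  "i \<in> {1..K} \<Longrightarrow> p \<in> prob_vectors K \<Longrightarrow> regular z \<Longrightarrow> \<bar>linreg i p z\<bar> \<le> M\<^sup>2"
  using mult_mono[OF mix_diff_bound[of i p z] deriv_mix_bound[of p z]] M
  by (simp add: linreg_def abs_mult power2_eq_square)

lemma linreg_sq_le:
  assumes "i \<in> {1..K}" "p \<in> prob_vectors K" "regular z"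
  shows "(linreg i p z)\<^sup>2 \<le> M\<^sup>2 * sqdist i p z"
proof -
  have "(deriv (\<lambda>u. l u (snd z)) (mix p (fst z)))\<^sup>2 \<le> M\<^sup>2"
    using power_mono[OF deriv_mix_bound[OF assms(2,3)], of 2] by simp
  from mult_right_mono[OF this, of "sqdist i p z"] show ?thesis
    by (simp add: linreg_def sqdist_def power_mult_distrib mult.commute)
qed

lemma offset_bound:
  assumes "i \<in> {1..K}" "p \<in> prob_vectors K" "regular z"
  shows "\<bar>offset i p z\<bar> \<le> 3 / 2 * M\<^sup>2"
proof -
  have "\<mu> / 4 * \<bar>sqdist i p z\<bar> \<le> 1 / 2 * M\<^sup>2"
    using sqdist_bound[OF assms] \<mu> by (intro mult_mono) auto
  then have "\<bar>\<mu> / 4 * sqdist i p z\<bar> \<le> 1 / 2 * M\<^sup>2" using \<mu> by (simp add: abs_mult)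
  then show ?thesis using linreg_bound[OF assms] unfolding offset_def by linarith
qed

text \<open>A Bernstein condition: the offset is the prediction gap times a factor of size at most
  \<open>3 / 2 * M\<close>, by \<open>\<mu> \<le> 2\<close>.\<close>

lemma offset_sq_le:
  assumes "i \<in> {1..K}" "p \<in> prob_vectors K" "regular z"
  shows "(offset i p z)\<^sup>2 \<le> 9 / 4 * M\<^sup>2 * sqdist i p z"
proof -
  define e where "e = mix p (fst z) - f i (fst z)"
  define g where "g = deriv (\<lambda>u. l u (snd z)) (mix p (fst z))"
  have "\<bar>\<mu> / 4 * e\<bar> \<le> 1 / 2 * M"
    using mix_diff_bound[OF assms] \<mu> unfolding e_def abs_mult by (intro mult_mono) auto
  moreover have "\<bar>g\<bar> \<le> M" using deriv_mix_bound[OF assms(2,3)] by (simp add: g_def)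
  ultimately have "\<bar>\<mu> / 4 * e - g\<bar> \<le> 3 / 2 * M" by linarith
  from power_mono[OF this, of 2] have "(\<mu> / 4 * e - g)\<^sup>2 \<le> 9 / 4 * M\<^sup>2"
    by (simp add: power_mult_distrib power2_eq_square)
  from mult_right_mono[OF this, of "e\<^sup>2"]
  have "(e * (\<mu> / 4 * e - g))\<^sup>2 \<le> 9 / 4 * M\<^sup>2 * e\<^sup>2"
    by (simp add: power_mult_distrib mult.commute)
  moreover have "offset i p z = e * (\<mu> / 4 * e - g)"
    by (simp add: offset_def sqdist_def linreg_def e_def g_def field_simps power2_eq_square)
  ultimately show ?thesis by (simp add: sqdist_def e_def)
qed

section \<open>Measurability and integrability\<close>

lemma fst_measurable [measurable]: "fst \<in> P \<rightarrow>\<^sub>M \<X>"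
  and snd_measurable [measurable]: "snd \<in> P \<rightarrow>\<^sub>M borel"
  using measurable_fst[of \<X> borel] measurable_snd[of \<X> borel]
  by (simp_all add: measurable_cong_sets[OF sets_P refl])

lemma f_measurable: "i \<in> {1..K} \<Longrightarrow> x \<in> N \<rightarrow>\<^sub>M \<X> \<Longrightarrow> (\<lambda>c. f i (x c)) \<in> borel_measurable N"
  using f_meas by (rule measurable_compose[rotated])

text \<open>Weights and observation both depend on a parameter, which covers fixed weights, weights
  computed from the sample, and pairs in a product space.\<close>

lemma mix_measurable:
  assumes "\<And>i. i \<in> {1..K} \<Longrightarrow> (\<lambda>c. p c i) \<in> borel_measurable N" and "x \<in> N \<rightarrow>\<^sub>M \<X>"
  shows "(\<lambda>c. mix (p c) (x c)) \<in> borel_measurable N"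
  unfolding mix_def prediction_def
  using assms by (intro borel_measurable_sum borel_measurable_times f_measurable) auto

lemma deriv_measurable:
  "a \<in> borel_measurable N \<Longrightarrow> b \<in> borel_measurable N \<Longrightarrow>
    (\<lambda>c. deriv (\<lambda>u. l u (b c)) (a c)) \<in> borel_measurable N"
  by (rule borel_measurable_deriv[OF l_meas l_diff])

lemma sqdist_measurable:
  assumes i: "i \<in> {1..K}" and p: "\<And>i. i \<in> {1..K} \<Longrightarrow> (\<lambda>c. p c i) \<in> borel_measurable N"
    and [measurable]: "z \<in> N \<rightarrow>\<^sub>M P"
  shows "(\<lambda>c. sqdist i (p c) (z c)) \<in> borel_measurable N"
proof -
  have [measurable]: "(\<lambda>c. fst (z c)) \<in> N \<rightarrow>\<^sub>M \<X>" by measurable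
  note [measurable] = mix_measurable[OF p this] f_measurable[OF i this]
  show ?thesis unfolding sqdist_def by measurable
qed

lemma offset_measurable:
  assumes i: "i \<in> {1..K}" and p: "\<And>i. i \<in> {1..K} \<Longrightarrow> (\<lambda>c. p c i) \<in> borel_measurable N"
    and z[measurable]: "z \<in> N \<rightarrow>\<^sub>M P"
  shows "(\<lambda>c. offset i (p c) (z c)) \<in> borel_measurable N"
proof -
  have [measurable]: "(\<lambda>c. fst (z c)) \<in> N \<rightarrow>\<^sub>M \<X>" "(\<lambda>c. snd (z c)) \<in> borel_measurable N"
    by measurable
  note [measurable] = mix_measurable[OF p this(1)] f_measurable[OF i this(1)]
    sqdist_measurable[OF i p z]
  note [measurable] = deriv_measurable[OF this(1) \<open>(\<lambda>c. snd (z c)) \<in> borel_measurable N\<close>]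
  show ?thesis unfolding offset_def linreg_def by measurable
qed

lemma sqdist_integrable:
  assumes "i \<in> {1..K}" and "p \<in> prob_vectors K"
  shows "integrable P (sqdist i p)"
proof (rule integrable_const_bound)
  show "AE z in P. norm (sqdist i p z) \<le> M\<^sup>2"
    using AE_regular by eventually_elim (use sqdist_bound[OF assms] in simp)
  show "sqdist i p \<in> borel_measurable P"
    using sqdist_measurable[of i "\<lambda>_. p" P "\<lambda>z. z"] assms by simp
qed

lemma offset_integrable:
  assumes "i \<in> {1..K}" and "p \<in> prob_vectors K"
  shows "integrable P (offset i p)"
proof (rule integrable_const_bound)
  show "AE z in P. norm (offset i p z) \<le> 3 / 2 * M\<^sup>2"
    using AE_regular by eventually_elim (use offset_bound[OF assms] in simp)
  show "offset i p \<in> borel_measurable P"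
    using offset_measurable[of i "\<lambda>_. p" P "\<lambda>z. z"] assms by simp
qed

section \<open>Exponential moment of a single round\<close>

text \<open>The weight of \<open>log (log T / \<delta>)\<close> in the threshold, and the tilting parameter \<open>1 / scale\<close> of
  the exponential supermartingale.\<close>

definition scale :: real where
  "scale = M\<^sup>2 * (32 / \<mu> + 3 * \<mu> + 4)"

text \<open>The first bound pays for the second moment of the offset; the second keeps
  \<open>offset / scale\<close> where the exponential has its quadratic bound.\<close>

lemma scale_ge: "32 * M\<^sup>2 \<le> \<mu> * scale" "16 * M\<^sup>2 \<le> scale" "0 < scale"
proof -
  have "\<mu> * scale = 32 * M\<^sup>2 + M\<^sup>2 * (3 * \<mu>\<^sup>2 + 4 * \<mu>)"
    using \<mu> by (simp add: scale_def field_simps power2_eq_square)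
  then show 1: "32 * M\<^sup>2 \<le> \<mu> * scale" using \<mu> by simp
  have "16 \<le> 32 / \<mu>" using \<mu> by (simp add: field_simps)
  then have "16 \<le> 32 / \<mu> + 3 * \<mu> + 4" using \<mu> by linarith
  then show 2: "16 * M\<^sup>2 \<le> scale" unfolding scale_def
    by (metis mult.commute mult_left_mono zero_le_power2)
  have "0 < 16 * M\<^sup>2" using M by simp
  then show "0 < scale" using 2 by linarith
qed

text \<open>Equals the mean of \<open>\<mu> / 2 * sqdist - linreg\<close>, the negative of the bound
  that strong convexity puts on the excess risk.\<close>

definition drift :: "nat \<Rightarrow> (nat \<Rightarrow> real) \<Rightarrow> real" where
  "drift i p = (\<integral>z. offset i p z \<partial>P) + \<mu> / 4 * (\<integral>z. sqdist i p z \<partial>P)"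

text \<open>The second moment of the offset is at most a multiple of the mean squared distance, which
  the strong convexity term inside the drift pays for.\<close>

lemma nn_integral_exp_offset_le_1:
  assumes i: "i \<in> {1..K}" and p: "p \<in> prob_vectors K"
  shows "(\<integral>\<^sup>+ z. ennreal (exp ((offset i p z - drift i p) / scale)) \<partial>P) \<le> 1"
proof -
  \<comment> \<open>The quadratic majorant of the exponential, with the squared offset already
    replaced by its bound through \<open>sqdist\<close>; its mean is explicit.\<close>
  let ?q = "\<lambda>z. 1 + offset i p z / scale + 9 / 4 * M\<^sup>2 / scale\<^sup>2 * sqdist i p z"
  let ?d = "drift i p / scale"
  note ints = offset_integrable[OF i p] sqdist_integrable[OF i p]
  have int: "integrable P ?q" using ints by simp
  have le: "exp (offset i p z / scale) \<le> ?q z" if "regular z" for z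
  proof -
    have "\<bar>offset i p z\<bar> \<le> scale" using offset_bound[OF i p that] scale_ge by linarith
    then have "exp (offset i p z / scale) \<le> 1 + offset i p z / scale + (offset i p z)\<^sup>2 / scale\<^sup>2"
      using exp_le_quadratic[of "offset i p z / scale"] scale_ge by (simp add: power_divide)
    moreover have "(offset i p z)\<^sup>2 / scale\<^sup>2 \<le> 9 / 4 * M\<^sup>2 * sqdist i p z / scale\<^sup>2"
      using offset_sq_le[OF i p that] by (intro divide_right_mono) auto
    ultimately show ?thesis by simp
  qed
  \<comment> \<open>After clearing denominators this reads
    \<open>9 * M\<^sup>2 \<le> \<mu> * scale\<close>.\<close>
  have "9 / 4 * M\<^sup>2 / scale\<^sup>2 \<le> \<mu> / 4 / scale"
  proof -
    have "9 * M\<^sup>2 \<le> \<mu> * scale" using scale_ge(1) zero_le_power2[of M] by linarith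
    then show ?thesis using scale_ge(3) by (simp add: field_simps power2_eq_square)
  qed
  moreover have "0 \<le> (\<integral>z. sqdist i p z \<partial>P)" by (simp add: sqdist_def)
  ultimately have "9 / 4 * M\<^sup>2 / scale\<^sup>2 * (\<integral>z. sqdist i p z \<partial>P) \<le> \<mu> / 4 / scale * (\<integral>z. sqdist i p z \<partial>P)"
    by (rule mult_right_mono)
  moreover have "(\<integral>z. ?q z \<partial>P) = 1 + (\<integral>z. offset i p z \<partial>P) / scale +
      9 / 4 * M\<^sup>2 / scale\<^sup>2 * (\<integral>z. sqdist i p z \<partial>P)"
    using ints by (simp add: prob_space)
  moreover have "?d = (\<integral>z. offset i p z \<partial>P) / scale + \<mu> / 4 / scale * (\<integral>z. sqdist i p z \<partial>P)"
    by (simp add: drift_def add_divide_distrib)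
  ultimately have "(\<integral>z. ?q z \<partial>P) \<le> 1 + ?d" by linarith
  also have "\<dots> \<le> exp ?d" by (rule exp_ge_add_one_self)
  finally have q: "(\<integral>z. ?q z \<partial>P) \<le> exp ?d" .
  have "(\<integral>z. exp (- ?d) * ?q z \<partial>P) = exp (- ?d) * (\<integral>z. ?q z \<partial>P)"
    by (rule integral_mult_right_zero)
  also have "\<dots> \<le> exp (- ?d) * exp ?d" using q by (intro mult_left_mono) auto
  also have "\<dots> = 1" by (simp flip: exp_add)
  finally have q1: "(\<integral>z. exp (- ?d) * ?q z \<partial>P) \<le> 1" .
  have "(\<integral>\<^sup>+ z. ennreal (exp ((offset i p z - drift i p) / scale)) \<partial>P) \<le>
    (\<integral>\<^sup>+ z. ennreal (exp (- ?d) * ?q z) \<partial>P)"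
  proof (rule nn_integral_mono_AE, use AE_regular in eventually_elim)
    fix z assume "regular z"
    from le[OF this] show "ennreal (exp ((offset i p z - drift i p) / scale)) \<le> ennreal (exp (- ?d) * ?q z)"
      by (intro ennreal_leI) (simp add: diff_divide_distrib exp_diff exp_minus field_simps)
  qed
  also have "\<dots> = ennreal (\<integral>z. exp (- ?d) * ?q z \<partial>P)"
  proof (rule nn_integral_eq_integral)
    show "integrable P (\<lambda>z. exp (- ?d) * ?q z)" using int by (intro integrable_mult_right)
    \<comment> \<open>Positivity of the majorant is inherited from the exponential that it dominates
      at regular points.\<close>
    show "AE z in P. 0 \<le> exp (- ?d) * ?q z"
      using AE_regular
      by eventually_elim (rule mult_nonneg_nonneg[OF exp_ge_zero order_trans[OF exp_ge_zero le]])
  qed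
  also have "\<dots> \<le> 1" using q1 by simp
  finally show ?thesis .
qed

section \<open>Risks of mixtures and of their averages\<close>

text \<open>Presents each \<open>f i\<close> as a mixture, so that comparisons of two mixtures also
  cover a single function.\<close>

definition unit_vector :: "nat \<Rightarrow> nat \<Rightarrow> real" where
  "unit_vector i j = (if j = i then 1 else 0)"

lemma unit_vector_prob: "i \<in> {1..K} \<Longrightarrow> unit_vector i \<in> prob_vectors K"
  by (simp add: prob_vectors_def unit_vector_def)

lemma mix_unit_vector: "i \<in> {1..K} \<Longrightarrow> mix (unit_vector i) = f i"
  by (rule ext) (simp add: mix_def prediction_def unit_vector_def if_distrib[of "\<lambda>c. c * _"] cong: if_cong)

definition mixloss :: "(nat \<Rightarrow> real) \<Rightarrow> 'a \<times> real \<Rightarrow> real" where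
  "mixloss p z = l (mix p (fst z)) (snd z)"

lemma risk_mix: "risk P l (mix p) = (\<integral>z. mixloss p z \<partial>P)"
  by (simp add: risk_def mixloss_def)

lemma risk_eq: "i \<in> {1..K} \<Longrightarrow> risk P l (f i) = (\<integral>z. mixloss (unit_vector i) z \<partial>P)"
  using risk_mix[of "unit_vector i"] by (simp add: mix_unit_vector)

lemma mixloss_measurable:
  assumes p: "\<And>i. i \<in> {1..K} \<Longrightarrow> (\<lambda>c. p c i) \<in> borel_measurable N"
    and [measurable]: "z \<in> N \<rightarrow>\<^sub>M P"
  shows "(\<lambda>c. mixloss (p c) (z c)) \<in> borel_measurable N"
proof -
  have [measurable]: "(\<lambda>c. fst (z c)) \<in> N \<rightarrow>\<^sub>M \<X>" by measurable
  note [measurable] = mix_measurable[OF p this]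
  have "(\<lambda>c. (mix (p c) (fst (z c)), snd (z c))) \<in> N \<rightarrow>\<^sub>M borel \<Otimes>\<^sub>M borel" by measurable
  from measurable_compose[OF this l_meas] show ?thesis by (simp add: mixloss_def)
qed

lemma loss_tangent:
  assumes "regular z" and "\<bar>x\<bar> \<le> M / 2" and "\<bar>y\<bar> \<le> M / 2"
  shows "l y (snd z) - l x (snd z) \<le> (y - x) * deriv (\<lambda>u. l u (snd z)) y - \<mu> / 2 * (x - y)\<^sup>2"
proof -
  have "x \<in> {- (M / 2)..M / 2}" "y \<in> {- (M / 2)..M / 2}" using assms by auto
  then show ?thesis using assms(1) unfolding regular_def by blast
qed

text \<open>The tangent at \<open>mix p\<close> bounds the difference by slope times distance, each
  at most \<open>M\<close>. Exchanging \<open>p\<close> and \<open>q\<close> gives the reverse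
  bound.\<close>

lemma mixloss_diff_le:
  assumes z: "regular z" and p: "p \<in> prob_vectors K" and q: "q \<in> prob_vectors K"
  shows "mixloss p z - mixloss q z \<le> M\<^sup>2"
proof -
  let ?x = "mix q (fst z)" and ?y = "mix p (fst z)"
  note b = mix_bound[OF p z] mix_bound[OF q z]
  have "(?y - ?x) * deriv (\<lambda>u. l u (snd z)) ?y \<le> \<bar>?y - ?x\<bar> * \<bar>deriv (\<lambda>u. l u (snd z)) ?y\<bar>"
    by (simp flip: abs_mult)
  also have "\<dots> \<le> M * M" using b deriv_mix_bound[OF p z] M by (intro mult_mono) auto
  finally have "(?y - ?x) * deriv (\<lambda>u. l u (snd z)) ?y \<le> M\<^sup>2" by (simp add: power2_eq_square)
  moreover have "0 \<le> \<mu> / 2 * (?x - ?y)\<^sup>2" using \<mu> by simp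
  ultimately show ?thesis using loss_tangent[OF z b(2,1)] unfolding mixloss_def by linarith
qed

text \<open>The loss itself need not be integrable, but differences of losses of mixtures are bounded:
  either all these losses are integrable or none is, and then all risks are \<open>0\<close>.\<close>

lemma mixloss_integrable_transfer:
  assumes p: "p \<in> prob_vectors K" and q: "q \<in> prob_vectors K" and int: "integrable P (mixloss q)"
  shows "integrable P (mixloss p)"
proof -
  have [measurable]: "mixloss p \<in> borel_measurable P" "mixloss q \<in> borel_measurable P"
    using mixloss_measurable[of "\<lambda>_. p" P "\<lambda>z. z"] mixloss_measurable[of "\<lambda>_. q" P "\<lambda>z. z"] by auto
  have "integrable P (\<lambda>z. mixloss p z - mixloss q z)"
  proof (rule integrable_const_bound)
    show "AE z in P. norm (mixloss p z - mixloss q z) \<le> M\<^sup>2"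
      using AE_regular by eventually_elim
        (use mixloss_diff_le[OF _ p q] mixloss_diff_le[OF _ q p] in \<open>force simp: abs_le_iff\<close>)
  qed measurable
  from Bochner_Integration.integrable_add[OF this int] show ?thesis by simp
qed

text \<open>Integrates the strong convexity inequality with tangent point \<open>mix p\<close>; its
  right-hand side \<open>linreg - \<mu> / 2 * sqdist\<close> is rewritten through the
  offset.\<close>

lemma risk_mix_le_drift:
  assumes i: "i \<in> {1..K}" and p: "p \<in> prob_vectors K" and int: "integrable P (mixloss (unit_vector i))"
  shows "risk P l (mix p) - risk P l (f i) \<le> - drift i p"
proof -
  note int_p = mixloss_integrable_transfer[OF p unit_vector_prob[OF i] int]
  note ints = sqdist_integrable[OF i p] offset_integrable[OF i p]
  have "risk P l (mix p) - risk P l (f i) = (\<integral>z. mixloss p z - mixloss (unit_vector i) z \<partial>P)"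
    using int int_p by (simp add: risk_mix risk_eq[OF i])
  also have "\<dots> \<le> (\<integral>z. - offset i p z - \<mu> / 4 * sqdist i p z \<partial>P)"
  proof (rule integral_mono_AE)
    show "AE z in P. mixloss p z - mixloss (unit_vector i) z \<le> - offset i p z - \<mu> / 4 * sqdist i p z"
      using AE_regular
    proof eventually_elim
      fix z assume z: "regular z"
      have "\<bar>f i (fst z)\<bar> \<le> M / 2" using z i by (auto simp: regular_def)
      from loss_tangent[OF z this mix_bound[OF p z]]
      show "mixloss p z - mixloss (unit_vector i) z \<le> - offset i p z - \<mu> / 4 * sqdist i p z"
        by (simp add: mixloss_def mix_unit_vector[OF i] offset_def linreg_def sqdist_def
            power2_commute[of "f i (fst z)"] field_simps)
    qed
  qed (use int int_p ints in auto)
  also have "\<dots> = - drift i p" using ints by (simp add: drift_def)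
  finally show ?thesis .
qed

text \<open>The output averages mixtures; by linearity it is a single mixture with these weights, so
  the bounds on \<open>mix\<close> apply to it.\<close>

definition average :: "nat \<Rightarrow> (nat \<Rightarrow> nat \<Rightarrow> real) \<Rightarrow> nat \<Rightarrow> real" where
  "average S p i = 1 / real S * (\<Sum>t=1..S. p t i)"

lemma average_prob:
  assumes S: "S \<ge> 1" and p: "\<And>t. p t \<in> prob_vectors K"
  shows "average S p \<in> prob_vectors K"
proof -
  have "0 \<le> average S p i" if "i \<in> {1..K}" for i
    using p that unfolding average_def prob_vectors_def by (auto intro!: sum_nonneg divide_nonneg_nonneg)
  moreover have "(\<Sum>i=1..K. average S p i) = 1 / real S * (\<Sum>t=1..S. \<Sum>i=1..K. p t i)"
    unfolding average_def sum_distrib_left by (rule sum.swap)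
  moreover have "(\<Sum>t=1..S. \<Sum>i=1..K. p t i) = real S"
    using p by (simp add: prob_vectors_def)
  ultimately show ?thesis using S by (simp add: prob_vectors_def)
qed

lemma mix_average: "mix (average S p) x = 1 / real S * (\<Sum>t=1..S. mix (p t) x)"
  unfolding mix_def prediction_def average_def sum_distrib_left sum_distrib_right mult.assoc
  by (rule sum.swap)

text \<open>Jensen's inequality, obtained from tangents at the averaged prediction.\<close>

lemma risk_mix_average_le:
  assumes S: "S \<ge> 1" and p: "\<And>t. p t \<in> prob_vectors K"
    and int: "\<And>t. integrable P (mixloss (p t))"
  shows "risk P l (mix (average S p)) \<le> 1 / real S * (\<Sum>t=1..S. risk P l (mix (p t)))"
proof -
  let ?q = "average S p"
  have q: "?q \<in> prob_vectors K" using S p by (rule average_prob)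
  have "risk P l (mix ?q) \<le> (\<integral>z. 1 / real S * (\<Sum>t=1..S. mixloss (p t) z) \<partial>P)"
    unfolding risk_mix
  proof (rule integral_mono_AE)
    show "integrable P (mixloss ?q)" using mixloss_integrable_transfer[OF q p int] .
    show "integrable P (\<lambda>z. 1 / real S * (\<Sum>t=1..S. mixloss (p t) z))"
      using int by auto
    show "AE z in P. mixloss ?q z \<le> 1 / real S * (\<Sum>t=1..S. mixloss (p t) z)"
      using AE_regular
    proof eventually_elim
      fix z assume z: "regular z"
      let ?y = "mix ?q (fst z)" and ?x = "\<lambda>t. mix (p t) (fst z)"
      let ?g = "deriv (\<lambda>u. l u (snd z)) ?y"
      have y: "real S * ?y = (\<Sum>t=1..S. ?x t)" using S by (simp add: mix_average)
      have "mixloss ?q z - mixloss (p t) z \<le> (?y - ?x t) * ?g" for t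
      proof -
        have "0 \<le> \<mu> / 2 * (?x t - ?y)\<^sup>2" using \<mu> by simp
        then show ?thesis using loss_tangent[OF z mix_bound[OF p z] mix_bound[OF q z], of t]
          unfolding mixloss_def by linarith
      qed
      then have "(\<Sum>t=1..S. mixloss ?q z - mixloss (p t) z) \<le> (\<Sum>t=1..S. (?y - ?x t) * ?g)"
        by (intro sum_mono)
      \<comment> \<open>The deviations from the average prediction sum to zero, and the slope does
        not depend on \<open>t\<close>.\<close>
      also have "\<dots> = 0" using y by (simp add: sum_subtractf flip: sum_distrib_right)
      finally show "mixloss ?q z \<le> 1 / real S * (\<Sum>t=1..S. mixloss (p t) z)"
        using S by (simp add: sum_subtractf field_simps)
    qed
  qed
  also have "\<dots> = 1 / real S * (\<Sum>t=1..S. risk P l (mix (p t)))"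
    using int by (simp add: risk_mix)
  finally show ?thesis .
qed

text \<open>The risk is a parameter integral, measurable in \<open>c\<close> because the loss is
  jointly measurable in \<open>c\<close> and the fresh observation.\<close>

lemma risk_mix_measurable:
  assumes "\<And>i. i \<in> {1..K} \<Longrightarrow> (\<lambda>c. p c i) \<in> borel_measurable N"
  shows "(\<lambda>c. risk P l (mix (p c))) \<in> borel_measurable N"
proof -
  have "(\<lambda>x. mixloss (p (fst x)) (snd x)) \<in> borel_measurable (N \<Otimes>\<^sub>M P)"
    using assms by (intro mixloss_measurable measurable_snd) (rule measurable_compose[OF measurable_fst])
  then show ?thesis
    unfolding risk_mix by (intro borel_measurable_lebesgue_integral) (simp add: case_prod_beta')
qed

lemma drift_measurable:
  assumes i: "i \<in> {1..K}" and p: "\<And>i. i \<in> {1..K} \<Longrightarrow> (\<lambda>c. p c i) \<in> borel_measurable N"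
  shows "(\<lambda>c. drift i (p c)) \<in> borel_measurable N"
proof -
  have p': "(\<lambda>x. p (fst x) i) \<in> borel_measurable (N \<Otimes>\<^sub>M P)" if "i \<in> {1..K}" for i
    using p[OF that] by (rule measurable_compose[OF measurable_fst])
  have "(\<lambda>(c, z). sqdist i (p c) z) \<in> borel_measurable (N \<Otimes>\<^sub>M P)"
    and "(\<lambda>(c, z). offset i (p c) z) \<in> borel_measurable (N \<Otimes>\<^sub>M P)"
    using sqdist_measurable[OF i p' measurable_snd] offset_measurable[OF i p' measurable_snd]
    by (simp_all add: case_prod_beta')
  then show ?thesis unfolding drift_def
    by (intro borel_measurable_add borel_measurable_times borel_measurable_const
        borel_measurable_lebesgue_integral)
qed

subsection \<open>The stopped algorithm\<close>

abbreviation weights :: "(nat \<Rightarrow> 'a \<times> real) \<Rightarrow> nat \<Rightarrow> nat \<Rightarrow> real" where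
  "weights \<equiv> otb_weights l K f (\<mu> / 8) M"

abbreviation guard :: "(nat \<Rightarrow> 'a \<times> real) \<Rightarrow> nat \<Rightarrow> bool" where
  "guard \<equiv> otb_guard l \<mu> K f T M (\<mu> / 8) \<theta>"

abbreviation steps :: "(nat \<Rightarrow> 'a \<times> real) \<Rightarrow> nat" where
  "steps \<equiv> otb_steps l \<mu> K f T M (\<mu> / 8) \<theta>"

lemma weights_prob: "weights z t \<in> prob_vectors K"
  unfolding otb_weights_def by (intro expert_weights_in_prob_vectors K)

lemma weights_cong: "(\<And>s. s \<in> {1..<t} \<Longrightarrow> z s = z' s) \<Longrightarrow> weights z t = weights z' t"
  unfolding otb_weights_def by (intro expert_weights_cong) auto

lemma guard_iff:
  "guard z s \<longleftrightarrow> s < T \<and> (\<exists>i\<in>{1..K}. \<mu> / 8 * (\<Sum>t=1..s. sqdist i (weights z t) (z t)) < \<theta>)"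
proof -
  have "guard z s \<longleftrightarrow> s < T \<and>
      (MIN i\<in>{1..K}. \<Sum>t=1..s. sqdist i (weights z t) (z t)) < 8 * \<theta> / \<mu>"
    using \<mu> by (auto simp: otb_guard_def sqdist_def mix_def otb_prediction_def field_simps)
  also have "\<dots> \<longleftrightarrow> s < T \<and> (\<exists>i\<in>{1..K}. (\<Sum>t=1..s. sqdist i (weights z t) (z t)) < 8 * \<theta> / \<mu>)"
    using K by (subst Min_less_iff) auto
  finally show ?thesis using \<mu> by (auto simp: field_simps)
qed

text \<open>Together with \<open>le_steps_iff\<close> this makes the decision to perform round
  \<open>t\<close> a function of the observations before \<open>t\<close>, as a stopped
  supermartingale requires.\<close>

lemma guard_cong:
  assumes "\<And>t. t \<in> {1..s} \<Longrightarrow> z t = z' t"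
  shows "guard z s = guard z' s"
proof -
  have "weights z t = weights z' t" if "t \<in> {1..s}" for t
    using that assms by (intro weights_cong) auto
  then have "(\<Sum>t=1..s. sqdist i (weights z t) (z t)) = (\<Sum>t=1..s. sqdist i (weights z' t) (z' t))" for i
    using assms by (intro sum.cong) auto
  then show ?thesis unfolding guard_iff by simp
qed

lemma not_guard_steps: "\<not> guard z (steps z)"
  unfolding otb_steps_def by (rule LeastI[of _ T]) (simp add: guard_iff)

lemma guard_less_steps: "s < steps z \<Longrightarrow> guard z s"
  unfolding otb_steps_def using not_less_Least by blast

lemma le_steps_iff: "t \<le> steps z \<longleftrightarrow> (\<forall>s<t. guard z s)"
  using not_guard_steps guard_less_steps by (meson leI le_trans less_le_trans)

lemma steps_le: "steps z \<le> T"
  unfolding otb_steps_def by (rule Least_le) (simp add: guard_iff)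

text \<open>At \<open>s = 0\<close> the sums are empty and the guard reduces to \<open>0 < T\<close>
  and \<open>0 < \<theta>\<close>; hence the output never divides by zero steps.\<close>

lemma steps_ge_1:
  assumes "0 < \<theta>" "T \<ge> 1"
  shows "1 \<le> steps z"
  unfolding le_steps_iff using assms K by (auto simp: guard_iff)

lemma otb_output_eq: "otb_output l \<mu> K f T M (\<mu> / 8) \<theta> z = mix (average (steps z) (weights z))"
  by (rule ext) (simp only: otb_output_def Let_def mix_average, simp add: mix_def prediction_def)

text \<open>Strong induction along the recursion: one unfolding expresses the weights through
  predictions and derivatives of earlier rounds.\<close>

lemma weights_measurable:
  assumes "\<And>s. s \<in> {1..<t} \<Longrightarrow> (\<lambda>c. z c s) \<in> N \<rightarrow>\<^sub>M P" and "i \<in> {1..K}"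
  shows "(\<lambda>c. weights (z c) t i) \<in> borel_measurable N"
  using assms
proof (induction t arbitrary: i rule: less_induct)
  case (less t)
  define u where "u s i c = \<mu> / 8 / M\<^sup>2 * (f i (fst (z c s)) - mix (weights (z c) s) (fst (z c s))) *
    deriv (\<lambda>u. l u (snd (z c s))) (mix (weights (z c) s) (fst (z c s)))" for s i c
  have eq: "(\<lambda>c. weights (z c) t i) = (\<lambda>c. exp (- (\<Sum>s\<in>{1..<t}. u s i c + (u s i c)\<^sup>2)) /
    (\<Sum>j=1..K. exp (- (\<Sum>s\<in>{1..<t}. u s j c + (u s j c)\<^sup>2))))" for i
    unfolding otb_weights_def by (subst expert_weights.simps)
      (simp add: u_def surrogate_loss_def mix_def otb_weights_def Let_def)
  have [measurable]: "u s i \<in> borel_measurable N" if s: "s \<in> {1..<t}" and i: "i \<in> {1..K}" for s i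
  proof -
    have w: "(\<lambda>c. weights (z c) s i) \<in> borel_measurable N" if "i \<in> {1..K}" for i
      using s that by (intro less.IH less.prems) auto
    have [measurable]: "(\<lambda>c. z c s) \<in> N \<rightarrow>\<^sub>M P" using less.prems(1)[OF s] .
    have x: "(\<lambda>c. fst (z c s)) \<in> N \<rightarrow>\<^sub>M \<X>" and y: "(\<lambda>c. snd (z c s)) \<in> borel_measurable N"
      by measurable
    note [measurable] = f_measurable[OF i x] mix_measurable[OF w x]
    note [measurable] = deriv_measurable[OF this(2) y]
    show ?thesis unfolding u_def by measurable
  qed
  show ?case unfolding eq using less.prems(2)
    by (intro borel_measurable_divide borel_measurable_exp borel_measurable_uminus
        borel_measurable_sum borel_measurable_add borel_measurable_power) auto
qed

lemma guard_measurable: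
  assumes z: "\<And>t. t \<in> {1..s} \<Longrightarrow> (\<lambda>c. z c t) \<in> N \<rightarrow>\<^sub>M P"
  shows "Measurable.pred N (\<lambda>c. guard (z c) s)"
proof -
  have [measurable]: "(\<lambda>c. \<Sum>t=1..s. sqdist i (weights (z c) t) (z c t)) \<in> borel_measurable N"
    if "i \<in> {1..K}" for i
    using z that by (intro borel_measurable_sum sqdist_measurable weights_measurable) auto
  show ?thesis unfolding guard_iff by measurable
qed

section \<open>The stopped supermartingale\<close>

text \<open>Rounds that are not performed contribute \<open>0\<close>, which turns a sum of random
  length into one over the fixed range \<open>{1..T}\<close>.\<close>

definition increment :: "nat \<Rightarrow> nat \<Rightarrow> (nat \<Rightarrow> 'a \<times> real) \<Rightarrow> real" where
  "increment i t z = (if \<forall>s<t. guard z s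
     then (offset i (weights z t) (z t) - drift i (weights z t)) / scale else 0)"

lemma increment_measurable:
  assumes i: "i \<in> {1..K}" and t: "t \<ge> 1" and z: "\<And>s. s \<in> {1..t} \<Longrightarrow> (\<lambda>c. z c s) \<in> N \<rightarrow>\<^sub>M P"
  shows "(\<lambda>c. increment i t (z c)) \<in> borel_measurable N"
proof -
  have w: "(\<lambda>c. weights (z c) t i) \<in> borel_measurable N" if "i \<in> {1..K}" for i
    using that z by (intro weights_measurable) auto
  have zt: "(\<lambda>c. z c t) \<in> N \<rightarrow>\<^sub>M P" using z t by auto
  note [measurable] = offset_measurable[OF i w zt] drift_measurable[OF i w]
  have "Measurable.pred N (\<lambda>c. guard (z c) s)" if "s \<in> {..<t}" for s
    by (rule guard_measurable) (use that z in auto)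
  then have "Measurable.pred N (\<lambda>c. \<forall>s\<in>{..<t}. guard (z c) s)"
    by (rule pred_intros_finite(3)[OF finite_lessThan])
  then have "Measurable.pred N (\<lambda>c. \<forall>s<t. guard (z c) s)"
    by (simp only: Ball_def lessThan_iff)
  moreover have "(\<lambda>c. (offset i (weights (z c) t) (z c t) - drift i (weights (z c) t)) / scale)
     \<in> borel_measurable N" by measurable
  ultimately show ?thesis
    unfolding increment_def pred_def by (intro measurable_If borel_measurable_const)
qed

lemma increment_cong:
  assumes i: "i \<in> {1..K}" and z: "\<And>s. s \<in> {1..t} \<Longrightarrow> z s = z' s" and t: "t \<ge> 1"
  shows "increment i t z = increment i t z'"
proof -
  have "weights z t = weights z' t" using z by (intro weights_cong) auto
  moreover have "guard z s = guard z' s" if "s < t" for s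
    using that z by (intro guard_cong) auto
  then have "(\<forall>s<t. guard z s) \<longleftrightarrow> (\<forall>s<t. guard z' s)" by blast
  moreover have "z t = z' t" using z t by auto
  ultimately show ?thesis by (simp only: increment_def)
qed

text \<open>With the past held fixed, the weights and the decision to perform round \<open>t\<close>
  are constants: either the bound for fixed weights applies, or the integrand is
  \<open>1\<close>.\<close>

lemma nn_integral_exp_increment_le_1:
  assumes i: "i \<in> {1..K}" and t: "t \<ge> 1"
  shows "(\<integral>\<^sup>+ y. ennreal (exp (increment i t (z(t := y)))) \<partial>P) \<le> 1"
proof -
  have w: "weights (z(t := y)) t = weights z t" for y by (intro weights_cong) auto
  have g: "guard (z(t := y)) s = guard z s" if "s < t" for y s
    using that by (intro guard_cong) auto
  show ?thesis
  proof (cases "\<forall>s<t. guard z s")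
    case True
    then show ?thesis using nn_integral_exp_offset_le_1[OF i weights_prob[of z t]]
      by (simp add: increment_def w g)
  next
    case False
    then have "increment i t (z(t := y)) = 0" for y by (auto simp: increment_def g)
    then show ?thesis by (simp add: emeasure_space_1)
  qed
qed

lemma sum_increment:
  "(\<Sum>t=1..T. increment i t z) =
    (\<Sum>t=1..steps z. offset i (weights z t) (z t) - drift i (weights z t)) / scale"
proof -
  have "(\<Sum>t=1..T. increment i t z) =
    (\<Sum>t=1..T. if t \<le> steps z then (offset i (weights z t) (z t) - drift i (weights z t)) / scale else 0)"
    by (simp add: increment_def le_steps_iff)
  also have "\<dots> = (\<Sum>t\<in>{1..T} \<inter> {t. t \<le> steps z}. (offset i (weights z t) (z t) - drift i (weights z t)) / scale)"
    by (subst sum.inter_restrict) auto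
  also have "{1..T} \<inter> {t. t \<le> steps z} = {1..steps z}" using steps_le[of z] by auto
  finally show ?thesis by (simp add: sum_divide_distrib)
qed

section \<open>Regret and excess risk on a regular sample\<close>

text \<open>The surrogate measures expert minus learner, so its linear part is
  \<open>- \<gamma> * linreg\<close>; its quadratic part is controlled by \<open>sqdist\<close>
  since slopes are at most \<open>M\<close>.\<close>

lemma linreg_regret:
  assumes i: "i \<in> {1..K}" and reg: "\<And>t. t \<in> {1..n} \<Longrightarrow> regular (z t)"
  shows "(\<Sum>t=1..n. linreg i (weights z t) (z t)) \<le>
    8 * M\<^sup>2 * ln (real K) / \<mu> + \<mu> / 8 * (\<Sum>t=1..n. sqdist i (weights z t) (z t))"
proof -
  \<comment> \<open>With this rate, \<open>ln K / \<gamma>\<close> and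
    \<open>\<gamma> * M\<^sup>2\<close> are the two coefficients in the bound.\<close>
  define \<gamma> where "\<gamma> = \<mu> / 8 / M\<^sup>2"
  let ?r = "\<lambda>t i. linreg i (weights z t) (z t)"
  have \<gamma>: "0 < \<gamma>" using \<mu> M by (simp add: \<gamma>_def)
  have u: "\<gamma> * (f i (fst (z t)) - mix (weights z t) (fst (z t))) *
      deriv (\<lambda>u. l u (snd (z t))) (mix (weights z t) (fst (z t))) = - (\<gamma> * ?r t i)" for t i
    by (simp add: linreg_def algebra_simps)
  have sl: "surrogate_loss K \<gamma> (\<lambda>i. f i (fst (z t))) (deriv (\<lambda>u. l u (snd (z t)))) (weights z t) i =
      - (\<gamma> * ?r t i) + (\<gamma> * ?r t i)\<^sup>2" for t i
    using u[of i t] by (simp add: surrogate_loss_def mix_def Let_def)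
  have small: "\<bar>\<gamma> * ?r t i\<bar> \<le> 1 / 2" if "t \<in> {1..n}" "i \<in> {1..K}" for t i
  proof -
    have "\<bar>\<gamma> * ?r t i\<bar> \<le> \<gamma> * M\<^sup>2"
      using linreg_bound[OF that(2) weights_prob reg[OF that(1)]] \<gamma> by (simp add: abs_mult)
    also have "\<dots> \<le> 1 / 2" using \<mu> M by (simp add: \<gamma>_def)
    finally show ?thesis .
  qed
  have "- ln (real K) \<le> (\<Sum>t=1..n. surrogate_loss K \<gamma> (\<lambda>i. f i (fst (z t)))
      (deriv (\<lambda>u. l u (snd (z t)))) (weights z t) i)"
    unfolding \<gamma>_def otb_weights_def
  proof (rule expert_weights_surrogate_regret[OF i])
    fix t j assume "t \<in> {1..n}" "j \<in> {1..K}"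
    from small[OF this] u[of j t]
    show "\<bar>\<mu> / 8 / M\<^sup>2 *
          (f j (fst (z t)) - prediction K (expert_weights K (\<mu> / 8) M (\<lambda>t i. f i (fst (z t)))
             (\<lambda>t. deriv (\<lambda>u. l u (snd (z t)))) t) (\<lambda>i. f i (fst (z t)))) *
          deriv (\<lambda>u. l u (snd (z t))) (prediction K (expert_weights K (\<mu> / 8) M (\<lambda>t i. f i (fst (z t)))
             (\<lambda>t. deriv (\<lambda>u. l u (snd (z t)))) t) (\<lambda>i. f i (fst (z t))))\<bar> \<le> 1 / 2"
      by (simp add: \<gamma>_def mix_def otb_weights_def)
  qed
  also have "\<dots> \<le> (\<Sum>t=1..n. - (\<gamma> * ?r t i) + \<gamma>\<^sup>2 * (M\<^sup>2 * sqdist i (weights z t) (z t)))"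
    unfolding sl power_mult_distrib using linreg_sq_le[OF i weights_prob reg]
    by (intro sum_mono add_left_mono mult_left_mono) auto
  also have "\<dots> = \<gamma> * (- (\<Sum>t=1..n. ?r t i) + \<gamma> * M\<^sup>2 * (\<Sum>t=1..n. sqdist i (weights z t) (z t)))"
    by (simp add: sum.distrib sum_subtractf sum_negf sum_distrib_left algebra_simps power2_eq_square)
  finally have "(\<Sum>t=1..n. ?r t i) \<le> ln (real K) / \<gamma> + \<gamma> * M\<^sup>2 * (\<Sum>t=1..n. sqdist i (weights z t) (z t))"
    using \<gamma> by (simp add: field_simps)
  then show ?thesis using M by (simp add: \<gamma>_def mult_ac)
qed

text \<open>Deterministic core: Jensen's inequality, the drift bound of each round, the deviation
  bound \<open>L\<close> and the regret bound are chained for one fixed sample.\<close>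

lemma excess_risk_le:
  assumes i: "i \<in> {1..K}" and int: "integrable P (mixloss (unit_vector i))"
    and reg: "\<And>t. t \<in> {1..T} \<Longrightarrow> regular (z t)" and S: "1 \<le> steps z"
    and L: "(\<Sum>t=1..T. increment i t z) \<le> L"
  shows "real (steps z) * (risk P l (otb_output l \<mu> K f T M (\<mu> / 8) \<theta> z) - risk P l (f i)) \<le>
    8 * M\<^sup>2 * ln (real K) / \<mu> + scale * L -
    \<mu> / 8 * (\<Sum>t=1..steps z. sqdist i (weights z t) (z t))"
proof -
  let ?S = "steps z"
  let ?q = "\<Sum>t=1..?S. sqdist i (weights z t) (z t)"
  have "risk P l (otb_output l \<mu> K f T M (\<mu> / 8) \<theta> z) \<le>
      1 / real ?S * (\<Sum>t=1..?S. risk P l (mix (weights z t)))"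
    unfolding otb_output_eq using S
    by (intro risk_mix_average_le weights_prob
        mixloss_integrable_transfer[OF weights_prob unit_vector_prob[OF i] int])
  then have "real ?S * (risk P l (otb_output l \<mu> K f T M (\<mu> / 8) \<theta> z) - risk P l (f i)) \<le>
      (\<Sum>t=1..?S. risk P l (mix (weights z t)) - risk P l (f i))"
    using S by (simp add: sum_subtractf field_simps)
  also have "\<dots> \<le> (\<Sum>t=1..?S. - drift i (weights z t))"
    by (intro sum_mono risk_mix_le_drift i int weights_prob)
  \<comment> \<open>Adding and subtracting the offsets brings in empirical quantities;
    \<open>- \<mu> / 4\<close> here and \<open>\<mu> / 8\<close> from the regret leave
    \<open>- \<mu> / 8\<close>.\<close>
  also have "\<dots> = (\<Sum>t=1..?S. offset i (weights z t) (z t) - drift i (weights z t)) +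
      (\<Sum>t=1..?S. linreg i (weights z t) (z t)) - \<mu> / 4 * ?q"
    by (simp add: offset_def sum_subtractf sum_negf sum_distrib_left)
  also have "(\<Sum>t=1..?S. offset i (weights z t) (z t) - drift i (weights z t)) \<le> scale * L"
    using L scale_ge(3) unfolding sum_increment by (simp add: field_simps)
  also have "(\<Sum>t=1..?S. linreg i (weights z t) (z t)) \<le> 8 * M\<^sup>2 * ln (real K) / \<mu> + \<mu> / 8 * ?q"
    using steps_le[of z] by (intro linreg_regret[OF i] reg) auto
  finally show ?thesis by linarith
qed

section \<open>Deviation bound in probability\<close>

text \<open>Markov's inequality for the exponential of the stopped sum, whose mean is at most
  \<open>1\<close>.\<close>

lemma prob_sum_increment_le:
  fixes W :: "'w measure" and Z :: "nat \<Rightarrow> 'w \<Rightarrow> 'a \<times> real"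
  assumes W: "prob_space W"
    and Z: "prob_space.indep_vars W (\<lambda>_. P) Z {1..T}" "\<And>t. t \<in> {1..T} \<Longrightarrow> distr W P (Z t) = P"
    and i: "i \<in> {1..K}" and \<delta>: "0 < \<delta>"
  shows "\<P>(\<omega> in W. (\<Sum>t=1..T. increment i t (\<lambda>t. Z t \<omega>)) \<le> ln (1 / \<delta>)) \<ge> 1 - \<delta>"
proof -
  interpret W: prob_space W by fact
  have rv: "Z t \<in> W \<rightarrow>\<^sub>M P" if "t \<in> {1..T}" for t
    using Z(1) that by (auto simp: W.indep_vars_def)
  let ?s = "\<lambda>\<omega>. \<Sum>t=1..T. increment i t (\<lambda>t. Z t \<omega>)"
  have [measurable]: "?s \<in> borel_measurable W"
    using rv by (intro borel_measurable_sum increment_measurable i) auto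
  \<comment> \<open>The factor is set to \<open>1\<close> at \<open>t = 0\<close>: there the
    congruence requirement compares arbitrary sequences, while \<open>increment i 0\<close> reads
    \<open>z 0\<close>.\<close>
  have "(\<integral>\<^sup>+ \<omega>. ennreal (exp (?s \<omega>)) \<partial>W) =
    (\<integral>\<^sup>+ \<omega>. (\<Prod>t=1..T. (\<lambda>z. if t \<ge> 1 then ennreal (exp (increment i t z)) else 1) (\<lambda>t. Z t \<omega>)) \<partial>W)"
    by (intro nn_integral_cong) (simp add: exp_sum prod_ennreal)
  also have "\<dots> \<le> 1"
  proof (rule nn_integral_indep_prod_le_1[OF W prob_space_axioms Z])
    fix t m :: nat assume t: "1 \<le> t" "t \<le> m" "m \<le> T"
    have "increment i t \<in> borel_measurable (\<Pi>\<^sub>M i\<in>{1..m}. P)"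
      using t by (intro increment_measurable[OF i] measurable_component_singleton) auto
    then show "(\<lambda>z. if t \<ge> 1 then ennreal (exp (increment i t z)) else 1) \<in>
      borel_measurable (\<Pi>\<^sub>M i\<in>{1..m}. P)" using t by simp
  next
    fix t :: nat and z z' :: "nat \<Rightarrow> 'a \<times> real" assume "\<And>s. s \<in> {1..t} \<Longrightarrow> z s = z' s"
    then show "(if t \<ge> 1 then ennreal (exp (increment i t z)) else 1) =
      (if t \<ge> 1 then ennreal (exp (increment i t z')) else 1)"
      using increment_cong[OF i, of t z z'] by auto
  next
    fix t z assume "t \<in> {1..T}"
    then show "(\<integral>\<^sup>+ y. (if t \<ge> 1 then ennreal (exp (increment i t (z(t := y)))) else 1) \<partial>P) \<le> 1"
      using nn_integral_exp_increment_le_1[OF i, of t z] by simp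
  qed
  finally have int: "(\<integral>\<^sup>+ \<omega>. ennreal (exp (?s \<omega>)) \<partial>W) \<le> 1" .
  have "emeasure W {\<omega> \<in> space W. 1 \<le> ennreal \<delta> * ennreal (exp (?s \<omega>))} \<le>
    ennreal \<delta> * (\<integral>\<^sup>+ \<omega>. ennreal (exp (?s \<omega>)) * indicator (space W) \<omega> \<partial>W)"
    by (intro nn_integral_Markov_inequality) measurable
  also have "\<dots> = ennreal \<delta> * (\<integral>\<^sup>+ \<omega>. ennreal (exp (?s \<omega>)) \<partial>W)"
    by (intro arg_cong[where f="\<lambda>x. ennreal \<delta> * x"] nn_integral_cong) simp
  also have "\<dots> \<le> ennreal \<delta> * 1" using int by (intro mult_left_mono) auto
  finally have "W.prob {\<omega> \<in> space W. 1 \<le> \<delta> * exp (?s \<omega>)} \<le> \<delta>"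
    using \<delta> by (simp add: W.emeasure_eq_measure flip: ennreal_mult)
  moreover have "W.prob {\<omega> \<in> space W. \<not> ?s \<omega> \<le> ln (1 / \<delta>)} \<le> W.prob {\<omega> \<in> space W. 1 \<le> \<delta> * exp (?s \<omega>)}"
  proof (rule W.finite_measure_mono)
    have "1 \<le> \<delta> * exp x" if "\<not> x \<le> ln (1 / \<delta>)" for x
    proof -
      have "exp (ln (1 / \<delta>)) \<le> exp x" using that by simp
      then show ?thesis using \<delta> by (simp add: field_simps)
    qed
    then show "{\<omega> \<in> space W. \<not> ?s \<omega> \<le> ln (1 / \<delta>)} \<subseteq> {\<omega> \<in> space W. 1 \<le> \<delta> * exp (?s \<omega>)}" by auto
  qed measurable
  moreover have "{\<omega> \<in> space W. ?s \<omega> \<le> ln (1 / \<delta>)} \<in> W.events" by measurable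
  ultimately show ?thesis using W.prob_neg[of "\<lambda>\<omega>. ?s \<omega> \<le> ln (1 / \<delta>)"] by linarith
qed

lemma AE_sample_regular:
  assumes "prob_space.indep_vars W (\<lambda>_. P) Z {1..T}" "prob_space W"
    and "\<And>t. t \<in> {1..T} \<Longrightarrow> distr W P (Z t) = P"
  shows "AE \<omega> in W. \<forall>t\<in>{1..T}. regular (Z t \<omega>)"
proof -
  interpret W: prob_space W by fact
  have "\<forall>t\<in>{1..T}. AE \<omega> in W. regular (Z t \<omega>)"
  proof
    fix t assume t: "t \<in> {1..T}"
    show "AE \<omega> in W. regular (Z t \<omega>)"
    proof (rule AE_distrD[where f="Z t" and M'=P])
      show "Z t \<in> W \<rightarrow>\<^sub>M P" using assms(1) t by (auto simp: W.indep_vars_def)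
      show "AE z in distr W P (Z t). regular z" unfolding assms(3)[OF t] by (rule AE_regular)
    qed
  qed
  then show ?thesis by (subst AE_ball_countable) auto
qed

section \<open>Measurability of the excess risk event\<close>

lemma average_measurable:
  assumes "\<And>t. t \<in> {1..n} \<Longrightarrow> (\<lambda>c. z c t) \<in> N \<rightarrow>\<^sub>M P" and "i \<in> {1..K}"
  shows "(\<lambda>c. average n (weights (z c)) i) \<in> borel_measurable N"
  unfolding average_def using assms
  by (intro borel_measurable_times borel_measurable_sum weights_measurable) auto

lemma steps_eq_iff: "steps z = n \<longleftrightarrow> (\<forall>s\<in>{..<n}. guard z s) \<and> \<not> guard z n"
proof
  assume "steps z = n"
  then show "(\<forall>s\<in>{..<n}. guard z s) \<and> \<not> guard z n"
    using not_guard_steps guard_less_steps by auto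
next
  assume n: "(\<forall>s\<in>{..<n}. guard z s) \<and> \<not> guard z n"
  then have "\<not> steps z < n" using not_guard_steps[of z] by auto
  moreover have "\<not> n < steps z" using n guard_less_steps by blast
  ultimately show "steps z = n" by simp
qed

text \<open>The number of averaged terms is random, so the event is split over the finitely many
  values of \<open>steps\<close>; for each of them the averaged weights are measurable.\<close>

lemma excess_risk_event_pred:
  assumes z: "\<And>t. t \<in> {1..T} \<Longrightarrow> (\<lambda>c. z c t) \<in> N \<rightarrow>\<^sub>M P"
  shows "Measurable.pred N (\<lambda>c. risk P l (otb_output l \<mu> K f T M (\<mu> / 8) \<theta> (z c)) - r \<le>
    (if steps (z c) < T then 0 else b))"
proof -
  let ?E = "\<lambda>c n. risk P l (mix (average n (weights (z c)))) - r \<le> (if n < T then 0 else b)"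
  have n_event: "Measurable.pred N (\<lambda>c. steps (z c) = n \<and> ?E c n)" if n: "n \<in> {..T}" for n
  proof (rule pred_intros_logic(3))
    have g: "Measurable.pred N (\<lambda>c. guard (z c) s)" if "s \<in> {..n}" for s
      by (rule guard_measurable) (use that n z in auto)
    then have "Measurable.pred N (\<lambda>c. \<forall>s\<in>{..<n}. guard (z c) s)"
      by (intro pred_intros_finite(3)[OF finite_lessThan]) simp
    moreover have "Measurable.pred N (\<lambda>c. \<not> guard (z c) n)"
      by (rule pred_intros_logic(2)[OF g]) simp
    ultimately show "Measurable.pred N (\<lambda>c. steps (z c) = n)"
      unfolding steps_eq_iff by (rule pred_intros_logic(3))
    have [measurable]: "(\<lambda>c. risk P l (mix (average n (weights (z c))))) \<in> borel_measurable N"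
      by (rule risk_mix_measurable, rule average_measurable) (use n z in auto)
    show "Measurable.pred N (\<lambda>c. ?E c n)" by measurable
  qed
  have "?E c (steps (z c)) \<longleftrightarrow> (\<exists>n\<in>{..T}. steps (z c) = n \<and> ?E c n)" for c
    using steps_le[of "z c"] by blast
  moreover have "Measurable.pred N (\<lambda>c. \<exists>n\<in>{..T}. steps (z c) = n \<and> ?E c n)"
    using n_event by (rule pred_intros_finite(4)[OF finite_atMost])
  ultimately show ?thesis by (simp only: otb_output_eq)
qed

lemma not_integrable_risk_eq_0:
  assumes i: "i \<in> {1..K}" and "\<not> integrable P (mixloss (unit_vector i))" and p: "p \<in> prob_vectors K"
  shows "risk P l (mix p) = 0"
  unfolding risk_mix using assms mixloss_integrable_transfer[OF unit_vector_prob[OF i] p]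
  by (blast intro: not_integrable_integral_eq)

end

section \<open>The excess risk bound with high probability\<close>

theorem theorem17:
  fixes W :: "'w measure" and \<X> :: "'a measure" and P :: "('a \<times> real) measure"
    and Z :: "nat \<Rightarrow> 'w \<Rightarrow> 'a \<times> real"
    and l :: "real \<Rightarrow> real \<Rightarrow> real" and f :: "nat \<Rightarrow> 'a \<Rightarrow> real"
    and K T :: nat and M \<mu> \<delta> \<theta> :: real
  assumes "prob_space W"
    and "prob_space P" and "sets P = sets (\<X> \<Otimes>\<^sub>M borel)"
    and "prob_space.indep_vars W (\<lambda>_. P) Z {1..T}"
    and "\<And>t. t \<in> {1..T} \<Longrightarrow> distr W P (Z t) = P"
    and "(\<lambda>(u, y). l u y) \<in> borel_measurable (borel \<Otimes>\<^sub>M borel)"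
    and "\<And>u y. (\<lambda>v. l v y) differentiable (at u)"
    and "K \<ge> 1"
    and "\<And>i. i \<in> {1..K} \<Longrightarrow> f i \<in> borel_measurable \<X>"
    and "M > 0" and "0 < \<mu>" and "\<mu> \<le> 2" and "T \<ge> 4" and "0 < \<delta>" and "\<delta> < 1 / 2"
    and "\<And>i. i \<in> {1..K} \<Longrightarrow> AE z in P. \<bar>f i (fst z)\<bar> \<le> M / 2"
    and "AE z in P. \<forall>y. \<bar>y\<bar> \<le> M / 2 \<longrightarrow> \<bar>deriv (\<lambda>u. l u (snd z)) y\<bar> \<le> M"
    and "strongly_convex_loss P M \<mu> l"
    and "\<theta> = 8 * M\<^sup>2 * ln (real K) / \<mu> + M\<^sup>2 * (32 / \<mu> + 3 * \<mu> + 4) * ln (ln (real T) / \<delta>)"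
  shows "\<P>(\<omega> in W.
      let z = (\<lambda>t. Z t \<omega>);
          S = otb_steps l \<mu> K f T M (\<mu> / 8) \<theta> z;
          fhat = otb_output l \<mu> K f T M (\<mu> / 8) \<theta> z
      in risk P l fhat - (MIN i\<in>{1..K}. risk P l (f i)) \<le>
           (if S < T then 0
            else M\<^sup>2 / (\<mu> * real T) *
                   (8 * ln (real K) + (32 + 3 * \<mu>\<^sup>2 + 4 * \<mu>) * ln (ln (real T) / \<delta>))))
    \<ge> 1 - \<delta>"
proof -
  interpret online_to_batch P \<X> l f K T M \<mu> \<theta>
    by (intro online_to_batch.intro online_to_batch_axioms.intro) (fact assms)+
  interpret W: prob_space W by fact
  define L where "L = ln (ln (real T) / \<delta>)"
  have L: "ln (1 / \<delta>) \<le> L" "0 < L"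
    using ln_ln_div_bounds[OF assms(13,14,15)] by (simp_all add: L_def)
  have \<theta>: "\<theta> = 8 * M\<^sup>2 * ln (real K) / \<mu> + scale * L"
    using assms(19) by (simp add: scale_def L_def)
  have "0 \<le> 8 * M\<^sup>2 * ln (real K) / \<mu>" using K \<mu> by simp
  moreover have "0 < scale * L" using scale_ge(3) L(2) by simp
  ultimately have \<theta>_pos: "0 < \<theta>" unfolding \<theta> by linarith
  \<comment> \<open>The bound claimed for \<open>S = T\<close> is the threshold divided by
    \<open>T\<close>.\<close>
  have b: "M\<^sup>2 / (\<mu> * real T) * (8 * ln (real K) + (32 + 3 * \<mu>\<^sup>2 + 4 * \<mu>) * ln (ln (real T) / \<delta>)) = \<theta> / real T"
    using \<mu> assms(13) by (simp add: \<theta> scale_def L_def field_simps power2_eq_square)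
  \<comment> \<open>The minimiser of the true risk does not depend on the sample, so one deviation
    bound suffices, without a union over the class.\<close>
  obtain i where i: "i \<in> {1..K}" and min: "(MIN i\<in>{1..K}. risk P l (f i)) = risk P l (f i)"
  proof -
    have "(MIN i\<in>{1..K}. risk P l (f i)) \<in> (\<lambda>i. risk P l (f i)) ` {1..K}"
      using K by (intro Min_in) auto
    then show ?thesis using that by auto
  qed
  have rv: "Z t \<in> W \<rightarrow>\<^sub>M P" if "t \<in> {1..T}" for t
    using assms(4) that by (auto simp: W.indep_vars_def)
  let ?z = "\<lambda>\<omega> t. Z t \<omega>"
  let ?E = "\<lambda>\<omega>. risk P l (otb_output l \<mu> K f T M (\<mu> / 8) \<theta> (?z \<omega>)) - risk P l (f i) \<le>
    (if steps (?z \<omega>) < T then 0 else \<theta> / real T)"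
  have "AE \<omega> in W. \<forall>t\<in>{1..T}. regular (Z t \<omega>)"
    using assms(5) by (rule AE_sample_regular[OF assms(4,1)])
  then have "AE \<omega> in W. (\<Sum>t=1..T. increment i t (?z \<omega>)) \<le> ln (1 / \<delta>) \<longrightarrow> ?E \<omega>"
  proof eventually_elim
    case (elim \<omega>)
    let ?S = "steps (?z \<omega>)"
    have S: "1 \<le> ?S" using \<theta>_pos assms(13) by (intro steps_ge_1) auto
    show ?case
    proof (intro impI, cases "integrable P (mixloss (unit_vector i))")
      case False
      \<comment> \<open>Without integrability both risks take the default value \<open>0\<close> of
        the integral, and the right-hand side is nonnegative.\<close>
      have "risk P l (mix (unit_vector i)) = 0"
        and "risk P l (mix (average ?S (weights (?z \<omega>)))) = 0"
        by (intro not_integrable_risk_eq_0[OF i False] unit_vector_prob[OF i] average_prob S weights_prob)+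
      then show "?E \<omega>" using \<theta>_pos by (simp add: otb_output_eq mix_unit_vector[OF i])
    next
      case True
      let ?q = "\<Sum>t=1..?S. sqdist i (weights (?z \<omega>) t) (Z t \<omega>)"
      assume "(\<Sum>t=1..T. increment i t (?z \<omega>)) \<le> ln (1 / \<delta>)"
      then have le: "real ?S * (risk P l (otb_output l \<mu> K f T M (\<mu> / 8) \<theta> (?z \<omega>)) - risk P l (f i))
          \<le> \<theta> - \<mu> / 8 * ?q"
        using excess_risk_le[OF i True _ S, of L] elim L(1) unfolding \<theta> by auto
      show "?E \<omega>"
      proof (cases "?S < T")
        case True
        \<comment> \<open>The loop ended although rounds remained, so every function, in particular
          \<open>i\<close>, has reached the threshold.\<close>
        then have "\<theta> \<le> \<mu> / 8 * ?q"
          using not_guard_steps[of "?z \<omega>"] i by (force simp: guard_iff)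
        with le have "real ?S * (risk P l (otb_output l \<mu> K f T M (\<mu> / 8) \<theta> (?z \<omega>)) - risk P l (f i)) \<le> 0"
          by linarith
        then show ?thesis using S True by (simp add: mult_le_0_iff)
      next
        case False
        \<comment> \<open>All rounds were performed; the subtracted squared distances are simply
          discarded.\<close>
        then have "?S = T" using steps_le[of "?z \<omega>"] by simp
        moreover have "0 \<le> \<mu> / 8 * ?q" using \<mu> by (auto simp: sqdist_def intro!: sum_nonneg mult_nonneg_nonneg)
        ultimately have "real T * (risk P l (otb_output l \<mu> K f T M (\<mu> / 8) \<theta> (?z \<omega>)) - risk P l (f i)) \<le> \<theta>"
          using le by simp
        then show ?thesis using False assms(13) by (simp add: field_simps)
      qed
    qed
  qed
  moreover have "Measurable.pred W ?E"
    by (rule excess_risk_event_pred[where z="?z"]) (rule rv)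
  then have "{\<omega> \<in> space W. ?E \<omega>} \<in> W.events" by (simp only: pred_def)
  ultimately have "\<P>(\<omega> in W. (\<Sum>t=1..T. increment i t (?z \<omega>)) \<le> ln (1 / \<delta>)) \<le> \<P>(\<omega> in W. ?E \<omega>)"
    by (intro W.finite_measure_mono_AE) (simp_all only: mem_Collect_eq, blast intro: eventually_mono)
  with prob_sum_increment_le[OF assms(1,4) assms(5) i assms(14)] have "1 - \<delta> \<le> \<P>(\<omega> in W. ?E \<omega>)"
    by linarith
  then show ?thesis unfolding Let_def min b .
qed

end
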